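(* Let $f(X)=N(N-1)\sum_{i=1}^{\ell}\beta_i\, t(H_i,X)$ be a subgraph-counting function (finite simple graphs $H_1,\dots,H_\ell$, real weights $\beta_1,\dots,\beta_\ell$), let $$C_{\boldsymbol\beta}=\max\Big\{12\sum_{i=1}^{\ell}|\beta_i|\,|E(H_i)|^2,\;2\Big\},$$ and let $$\mathcal X_f=\Big\{X\in[0,1]^n:\ \Big\|X-\tfrac{\mathbf 1+\tanh(\nabla f(X))}{2}\Big\|_1\le 5000\,C_{\boldsymbol\beta}^2\,n^{15/16}\Big\}.$$ Then there exists a probability measure $\rho$ on $[0,1]^n$ (depending on $n$ and $f$) such that the exponential random graph $G_N^f$ is a $\big(\rho,\,80\,C_{\boldsymbol\beta}\,n^{-1/16}\big)$-mixture and $$\rho(\mathcal X_f)\ge 1-\frac{80\,C_{\boldsymbol\beta}}{n^{1/16}}.$$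
   Context: Fix an integer $N\ge 2$ (number of vertices) and set $n=\binom N2$. Vectors $X\in[0,1]^n$ are identified with symmetric $N\times N$ matrices with zero diagonal whose off-diagonal entries $X_{ij}=X_{ji}$ are indexed by unordered pairs $\{i,j\}$ (edge-weighted graphs on $[N]$); vectors in $\{0,1\}^n$ are identified with simple graphs on $[N]$. For a finite simple graph $H$ on vertex set $[m]$ and $X\in[0,1]^n$, set $t(H,X)=\frac{1}{N(N-1)\cdots(N-m+1)}\sum_{q}\prod_{\{l,l'\}\in E(H)}X_{q_l q_{l'}}$, the sum over all injective maps $q:[m]\to[N]$ (for a simple graph this is the number of injective homomorphisms $H\to G$ divided by $N(N-1)\cdots(N-m+1)$). For an edge index $e=\{i,j\}$, $\partial_e f(X)=\frac12\big(f(X^{e\leftarrow 1})-f(X^{e\leftarrow 0})\big)$, where $X^{e\leftarrow a}$ is $X$ with coordinate $e$ replaced by $a$; $\nabla f(X)=(\partial_e f(X))_{e}\in\mathbb R^n$ (defined for all $X\in[0,1]^n$ since $f$ is affine in each coordinate). $\mathbf 1$ is the matrix with zero diagonal and all off-diagonal entries $1$; $\tanh$ is applied entrywise; $\|\cdot\|_1$ is the $\ell^1$ norm on $\mathbb R^n$. The exponential random graph $G_N^f$ is the random element of $\{0,1\}^n$ with $\Pr[G_N^f=G]=\exp(f(G))/Z$, $Z$ a normalizing constant. For $\vec p\in[0,1]^n$, $G(N,\vec p)$ is the random graph with independent edges, edge $\{i,j\}$ present with probability $\vec p_{ij}$; for a measure $\rho$ on $[0,1]^n$, $G(N,\rho)$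 is defined by $\Pr[G(N,\rho)=G]=\int\Pr[G(N,\vec p)=G]\,d\rho(\vec p)$. A random graph $G$ is a $(\rho,\delta)$-mixture if there is a coupling of $G(N,\rho)$ and $G$ with $\mathbb E\|G(N,\rho)-G\|_1\le\delta n$. *)

theory Defs
  imports "HOL-Probability.Probability"
begin

text \<open>Vertices are 0..N-1. An edge index {i,j} is represented by the pair (i,j) with i<j.
 Vectors X in [0,1]^n are functions (nat*nat) => real, only values on edge_set N matter.\<close>

definition edge_set :: "nat \<Rightarrow> (nat \<times> nat) set" where
  "edge_set N = {(i,j). i < j \<and> j < N}"

definition entry :: "((nat \<times> nat) \<Rightarrow> real) \<Rightarrow> nat \<Rightarrow> nat \<Rightarrow> real" where
  "entry X i j = (if i < j then X (i,j) else if j < i then X (j,i) else 0)"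

text \<open>A finite simple graph H on vertex set [m] = {0..<m}: a pair (m, E) with
 E a set of pairs (a,b), a < b < m.\<close>
definition simple_graph :: "nat \<times> (nat \<times> nat) set \<Rightarrow> bool" where
  "simple_graph H = (snd H \<subseteq> {(a,b). a < b \<and> b < fst H})"

definition hom_density :: "nat \<Rightarrow> nat \<times> (nat \<times> nat) set \<Rightarrow> ((nat \<times> nat) \<Rightarrow> real) \<Rightarrow> real" where
  "hom_density N H X =
     (\<Sum>q\<in>{q \<in> {0..<fst H} \<rightarrow>\<^sub>E {0..<N}. inj_on q {0..<fst H}}.
        \<Prod>(l,l')\<in>snd H. entry X (q l) (q l'))
     / (\<Prod>k<fst H. (real N - real k))"

definition subgraph_fun :: "nat \<Rightarrow> ((nat \<times> (nat \<times> nat) set) \<times> real) list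
     \<Rightarrow> ((nat \<times> nat) \<Rightarrow> real) \<Rightarrow> real" where
  "subgraph_fun N Hs X = real N * (real N - 1) *
     (\<Sum>i<length Hs. snd (Hs ! i) * hom_density N (fst (Hs ! i)) X)"

definition pdiff :: "(((nat \<times> nat) \<Rightarrow> real) \<Rightarrow> real) \<Rightarrow> nat \<times> nat \<Rightarrow> ((nat \<times> nat) \<Rightarrow> real) \<Rightarrow> real" where
  "pdiff f e X = (f (X(e := 1)) - f (X(e := 0))) / 2"

definition C_beta :: "((nat \<times> (nat \<times> nat) set) \<times> real) list \<Rightarrow> real" where
  "C_beta Hs = max (12 * (\<Sum>i<length Hs. \<bar>snd (Hs ! i)\<bar> * real (card (snd (fst (Hs ! i)))) ^ 2)) 2"

definition cube :: "nat \<Rightarrow> ((nat \<times> nat) \<Rightarrow> real) set" where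
  "cube N = edge_set N \<rightarrow>\<^sub>E {0..1}"

definition X_f :: "nat \<Rightarrow> (((nat \<times> nat) \<Rightarrow> real) \<Rightarrow> real) \<Rightarrow> real \<Rightarrow> ((nat \<times> nat) \<Rightarrow> real) set" where
  "X_f N f C = {X \<in> cube N.
     (\<Sum>e\<in>edge_set N. \<bar>X e - (1 + tanh (pdiff f e X)) / 2\<bar>)
       \<le> 5000 * C ^ 2 * real (N choose 2) powr (15/16)}"

text \<open>Graphs on [N] are edge sets G \<subseteq> edge_set N; indicator vector.\<close>
definition gvec :: "(nat \<times> nat) set \<Rightarrow> (nat \<times> nat) \<Rightarrow> real" where
  "gvec G = (\<lambda>e. if e \<in> G then 1 else 0)"

definition erg_prob :: "nat \<Rightarrow> (((nat \<times> nat) \<Rightarrow> real) \<Rightarrow> real) \<Rightarrow> (nat \<times> nat) set \<Rightarrow> real" where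
  "erg_prob N f G = (if G \<subseteq> edge_set N
      then exp (f (gvec G)) / (\<Sum>G'\<in>Pow (edge_set N). exp (f (gvec G'))) else 0)"

definition indep_prob :: "nat \<Rightarrow> ((nat \<times> nat) \<Rightarrow> real) \<Rightarrow> (nat \<times> nat) set \<Rightarrow> real" where
  "indep_prob N p G = (if G \<subseteq> edge_set N
      then (\<Prod>e\<in>edge_set N. if e \<in> G then p e else 1 - p e) else 0)"

definition mix_prob :: "nat \<Rightarrow> ((nat \<times> nat) \<Rightarrow> real) measure \<Rightarrow> (nat \<times> nat) set \<Rightarrow> real" where
  "mix_prob N \<rho> G = (\<integral>p. indep_prob N p G \<partial>\<rho>)"

text \<open>A random graph with law P (given by its probability function) is a (rho,delta)-mixture:
 there is a coupling of G(N,rho) and it with E ||G(N,rho) - G||_1 \<le> delta n.\<close>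
definition is_mixture :: "nat \<Rightarrow> ((nat \<times> nat) \<Rightarrow> real) measure \<Rightarrow> real
     \<Rightarrow> ((nat \<times> nat) set \<Rightarrow> real) \<Rightarrow> bool" where
  "is_mixture N \<rho> \<delta> P = (\<exists>\<mu> :: ((nat \<times> nat) set \<times> (nat \<times> nat) set) pmf.
      (\<forall>G. pmf (map_pmf fst \<mu>) G = mix_prob N \<rho> G) \<and>
      (\<forall>G. pmf (map_pmf snd \<mu>) G = P G) \<and>
      measure_pmf.expectation \<mu> (\<lambda>(A,B). real (card (A - B \<union> (B - A))))
         \<le> \<delta> * real (N choose 2))"

end

theory Submission
  imports Defs
begin

text \<open>Write \<open>D\<^sub>e(X)\<close> for the discrete derivative of \<open>f\<close>. Each \<open>D\<^sub>e\<close> is an average, over random placements of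
  some \<open>H\<^sub>i\<close> with one of its edges put on \<open>e\<close>, of products of entries of \<open>X\<close>. Hence it is approximated in
  mean square by an average \<open>g\<^sub>e\<close> of about \<open>n\<^bsup>3/8\<^esup>\<close> samples. The vertices used by the samples can
  be chosen independently of \<open>e\<close>, so all \<open>g\<^sub>e\<close> depend only on the set \<open>S\<close> of edges touching a set of
  \<open>O(n\<^bsup>3/8\<^esup>)\<close> vertices, and \<open>S\<close> contains only \<open>O(n\<^bsup>7/8\<^esup>)\<close> edges.

  In the exponential random graph \<open>X\<close>, an edge is present with conditional probability
  \<open>(1 + tanh D\<^sub>e(X)) / 2\<close> given all other edges. So given the restriction of \<open>X\<close> to \<open>S\<close>, the graph is close in
  Hamming distance to the product measure with marginals \<open>p\<^sub>e = (1 + tanh g\<^sub>e) / 2\<close>; the measure \<open>\<rho>\<close> is the law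
  of \<open>p\<close>. By multilinearity \<open>D\<^sub>e(p)\<close> is the mean of \<open>D\<^sub>e\<close> under the product measure, and the coupling together with the
  \<open>\<ell>\<^sup>1\<close>-Lipschitz bound for the gradient shows that \<open>D\<^sub>e(p)\<close> is close to \<open>g\<^sub>e\<close> for most \<open>e\<close>, so that \<open>p\<close> is an
  approximate fixed point.\<close>

section \<open>Couplings with product measures\<close>

lemma sum_Pow_insert:
  fixes g :: "'a set \<Rightarrow> 'b::comm_monoid_add"
  assumes "finite F" "x \<notin> F"
  shows "sum g (Pow (insert x F)) = (\<Sum>B\<in>Pow F. g B + g (insert x B))"
proof -
  have inj: "inj_on (insert x) (Pow F)"
    using assms by (auto simp: inj_on_def)
  have "sum g (Pow (insert x F)) = sum g (Pow F) + sum g (insert x ` Pow F)"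
    unfolding Pow_insert by (rule sum.union_disjoint) (use assms in auto)
  also have "sum g (insert x ` Pow F) = (\<Sum>B\<in>Pow F. g (insert x B))"
    by (simp add: sum.reindex[OF inj])
  finally show ?thesis by (simp add: sum.distrib)
qed

text \<open>The edges are coupled one at a time. Given the part of the Gibbs sample exposed so far, the new
  indicator has some conditional mean \<open>r\<close>; it is coupled optimally with a Bernoulli \<open>p k\<close> variable, which
  keeps the first marginal a product measure. The cost \<open>\<bar>p k - r\<bar>\<close> is tested against the
  function \<open>u = sgn\<close>, which does not depend on the new indicator; hypotheses in terms of such test
  functions pass to marginals, and this makes the induction work.\<close>

lemma sequential_coupling:
  fixes M :: "'a set \<Rightarrow> real" and p c :: "'a \<Rightarrow> real"
  assumes "finite F"
    and "\<And>k. 0 \<le> p k" "\<And>k. p k \<le> 1"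
    and "\<And>B. 0 \<le> M B"
    and "\<And>k u. k \<in> F \<Longrightarrow> (\<And>B. \<bar>u B\<bar> \<le> 1) \<Longrightarrow> (\<And>B. u (insert k B) = u (B - {k})) \<Longrightarrow>
           (\<Sum>B\<in>Pow F. M B * ((if k \<in> B then 1 else 0) - p k) * u B) \<le> c k"
  shows "\<exists>K. (\<forall>A B. 0 \<le> K A B) \<and>
     (\<forall>A\<in>Pow F. (\<Sum>B\<in>Pow F. K A B) = (\<Sum>B\<in>Pow F. M B) * (\<Prod>e\<in>F. if e \<in> A then p e else 1 - p e)) \<and>
     (\<forall>B\<in>Pow F. (\<Sum>A\<in>Pow F. K A B) = M B) \<and>
     (\<Sum>A\<in>Pow F. \<Sum>B\<in>Pow F. K A B * real (card (A - B \<union> (B - A)))) \<le> (\<Sum>k\<in>F. c k)"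
  using assms(1,4,5)
proof (induction F arbitrary: M rule: finite_induct)
  case empty
  then show ?case
    by (intro exI[of _ "\<lambda>A B. M {}"]) auto
next
  case (insert x F)
  \<comment> \<open>\<open>M'\<close> is the marginal of \<open>M\<close> with \<open>x\<close>
    forgotten. The other coordinates are coupled first, and \<open>x\<close> is exposed
    last.\<close>
  define M' where "M' = (\<lambda>B. M B + M (insert x B))"
  have M'_nonneg: "0 \<le> M' B" for B
    using insert.prems(1) by (simp add: M'_def)
  have test': "(\<Sum>B\<in>Pow F. M' B * ((if k \<in> B then 1 else 0) - p k) * u B) \<le> c k"
    if k: "k \<in> F" and u1: "\<And>B. \<bar>u B\<bar> \<le> 1" and u2: "\<And>B. u (insert k B) = u (B - {k})" for k u
  proof -
    have kx: "k \<noteq> x" using k insert.hyps by auto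
    \<comment> \<open>Forgetting \<open>x\<close> commutes with inserting or deleting
      \<open>k\<close>, so the pulled-back test function is still blind to \<open>k\<close>. Summing
      out \<open>x\<close> then returns the bound for \<open>M'\<close>.\<close>
    have "(\<Sum>B\<in>Pow (insert x F). M B * ((if k \<in> B then 1 else 0) - p k) * u (B - {x})) \<le> c k"
    proof (rule insert.prems(2)[of k "\<lambda>B. u (B - {x})"])
      fix B
      have "insert k B - {x} = insert k (B - {x})" using kx by auto
      moreover have "B - {x} - {k} = B - {k} - {x}" by auto
      ultimately show "u (insert k B - {x}) = u (B - {k} - {x})"
        using u2[of "B - {x}"] by simp
    qed (use k u1 in auto)
    moreover have "(\<Sum>B\<in>Pow (insert x F). M B * ((if k \<in> B then 1 else 0) - p k) * u (B - {x}))
        = (\<Sum>B\<in>Pow F. M' B * ((if k \<in> B then 1 else 0) - p k) * u B)"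
      unfolding sum_Pow_insert[OF insert.hyps]
    proof (rule sum.cong)
      fix B assume "B \<in> Pow F"
      then have "x \<notin> B" using insert.hyps by auto
      then show "M B * ((if k \<in> B then 1 else 0) - p k) * u (B - {x}) +
         M (insert x B) * ((if k \<in> insert x B then 1 else 0) - p k) * u (insert x B - {x}) =
         M' B * ((if k \<in> B then 1 else 0) - p k) * u B"
        using kx by (simp add: M'_def algebra_simps)
    qed simp
    ultimately show ?thesis by simp
  qed
  obtain K' where K'0: "\<And>A B. 0 \<le> K' A B"
    and K'1: "\<And>A. A \<in> Pow F \<Longrightarrow> (\<Sum>B\<in>Pow F. K' A B) =
        (\<Sum>B\<in>Pow F. M' B) * (\<Prod>e\<in>F. if e \<in> A then p e else 1 - p e)"
    and K'2: "\<And>B. B \<in> Pow F \<Longrightarrow> (\<Sum>A\<in>Pow F. K' A B) = M' B"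
    and K'3: "(\<Sum>A\<in>Pow F. \<Sum>B\<in>Pow F. K' A B * real (card (A - B \<union> (B - A)))) \<le> (\<Sum>k\<in>F. c k)"
    using insert.IH[OF M'_nonneg test'] by blast
  \<comment> \<open>This is the conditional probability of \<open>x\<close> given the rest. Where
    \<open>M' B = 0\<close> the quotient is 0 by convention, which is harmless because both masses
    above \<open>B\<close> vanish there.\<close>
  define r where "r = (\<lambda>B. M (insert x B) / M' B)"
  have r0: "0 \<le> r B" and r1: "r B \<le> 1" for B
    using insert.prems(1)[of B] insert.prems(1)[of "insert x B"]
    by (auto simp: r_def M'_def divide_simps)
  have M'r: "M' B * r B = M (insert x B)" "M' B * (1 - r B) = M B" for B
    using insert.prems(1)[of B] insert.prems(1)[of "insert x B"]
    by (cases "M' B = 0"; force simp: r_def M'_def field_simps)+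
  \<comment> \<open>The maximal coupling of Bernoulli variables with means \<open>p x\<close> and
    \<open>t\<close>: they are both 1 with the smaller of the two probabilities, so the two
    disagreement cells add up to \<open>|p x - t|\<close>.\<close>
  define J where "J = (\<lambda>a b t. if a then (if b then min (p x) t else p x - min (p x) t)
      else (if b then t - min (p x) t else 1 - p x - t + min (p x) t))"
  have J0: "0 \<le> J a b (r B)" for a b B
    using assms(2)[of x] assms(3)[of x] r0[of B] r1[of B] by (auto simp: J_def min_def)
  define K where "K = (\<lambda>A B. K' (A - {x}) (B - {x}) * J (x \<in> A) (x \<in> B) (r (B - {x})))"
  have minus: "B - {x} = B" "insert x B - {x} = B" "x \<notin> B" if "B \<in> Pow F" for B
    using that insert.hyps by auto
  have fst_marg: "(\<Sum>B\<in>Pow (insert x F). K A B) = (\<Sum>B\<in>Pow (insert x F). M B) *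
      (\<Prod>e\<in>insert x F. if e \<in> A then p e else 1 - p e)" if A: "A \<in> Pow (insert x F)" for A
  proof -
    have "(\<Sum>B\<in>Pow (insert x F). K A B)
        = (\<Sum>B\<in>Pow F. K' (A - {x}) B * (if x \<in> A then p x else 1 - p x))"
      unfolding sum_Pow_insert[OF insert.hyps]
    proof (rule sum.cong)
      fix B assume "B \<in> Pow F"
      then show "K A B + K A (insert x B) = K' (A - {x}) B * (if x \<in> A then p x else 1 - p x)"
        by (simp add: K_def minus J_def algebra_simps)
    qed simp
    also have "\<dots> = (\<Sum>B\<in>Pow F. M' B) * (\<Prod>e\<in>F. if e \<in> A - {x} then p e else 1 - p e)
        * (if x \<in> A then p x else 1 - p x)"
      using A by (subst K'1[symmetric]) (auto simp: sum_distrib_right)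
    also have "(\<Prod>e\<in>F. if e \<in> A - {x} then p e else 1 - p e) = (\<Prod>e\<in>F. if e \<in> A then p e else 1 - p e)"
      using insert.hyps by (intro prod.cong) auto
    also have "(\<Sum>B\<in>Pow F. M' B) = (\<Sum>B\<in>Pow (insert x F). M B)"
      unfolding sum_Pow_insert[OF insert.hyps] M'_def ..
    finally show ?thesis using insert.hyps by (simp add: mult_ac)
  qed
  have snd_marg: "(\<Sum>A\<in>Pow (insert x F). K A B) = M B" if B: "B \<in> Pow (insert x F)" for B
  proof -
    have BF: "B - {x} \<in> Pow F" using B by auto
    have "(\<Sum>A\<in>Pow (insert x F). K A B)
        = (\<Sum>A\<in>Pow F. K' A (B - {x}) * (if x \<in> B then r (B - {x}) else 1 - r (B - {x})))"
      unfolding sum_Pow_insert[OF insert.hyps]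
    proof (rule sum.cong)
      fix A assume "A \<in> Pow F"
      then show "K A B + K (insert x A) B =
          K' A (B - {x}) * (if x \<in> B then r (B - {x}) else 1 - r (B - {x}))"
        by (simp add: K_def minus J_def algebra_simps)
    qed simp
    also have "\<dots> = M' (B - {x}) * (if x \<in> B then r (B - {x}) else 1 - r (B - {x}))"
      using BF by (subst K'2[symmetric]) (auto simp: sum_distrib_right)
    also have "\<dots> = M B"
      by (simp add: M'r insert_absorb)
    finally show ?thesis .
  qed
  have cost_x: "(\<Sum>A\<in>Pow F. \<Sum>B\<in>Pow F. K' A B * \<bar>p x - r B\<bar>) \<le> c x"
  proof -
    \<comment> \<open>Clearing the denominator \<open>M'\<close> turns the cost of \<open>x\<close>
      into a sum of absolute values. Their signs depend on \<open>B - {x}\<close> only, so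
      \<open>u\<close> is an admissible test function.\<close>
    define u where "u = (\<lambda>B. sgn (M (insert x (B - {x})) * (1 - p x) - M (B - {x}) * p x))"
    have "(\<Sum>A\<in>Pow F. \<Sum>B\<in>Pow F. K' A B * \<bar>p x - r B\<bar>) = (\<Sum>B\<in>Pow F. M' B * \<bar>p x - r B\<bar>)"
      by (subst sum.swap) (simp add: K'2 flip: sum_distrib_right)
    also have "\<dots> = (\<Sum>B\<in>Pow F. \<bar>M (insert x B) * (1 - p x) - M B * p x\<bar>)"
    proof (rule sum.cong)
      fix B
      have "M' B * \<bar>p x - r B\<bar> = \<bar>M' B * r B * (1 - p x) - M' B * (1 - r B) * p x\<bar>"
        by (subst abs_of_nonneg[OF M'_nonneg[of B], symmetric], subst abs_mult[symmetric],
            subst abs_minus_commute[symmetric], intro arg_cong[where f=abs]) (simp add: algebra_simps)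
      then show "M' B * \<bar>p x - r B\<bar> = \<bar>M (insert x B) * (1 - p x) - M B * p x\<bar>"
        by (simp add: M'r)
    qed simp
    also have "\<dots> = (\<Sum>B\<in>Pow (insert x F). M B * ((if x \<in> B then 1 else 0) - p x) * u B)"
      unfolding sum_Pow_insert[OF insert.hyps]
    proof (rule sum.cong)
      fix B assume "B \<in> Pow F"
      note m = minus[OF this]
      have "\<bar>y\<bar> = y * sgn y" for y :: real by (simp add: abs_sgn)
      then show "\<bar>M (insert x B) * (1 - p x) - M B * p x\<bar> =
         M B * ((if x \<in> B then 1 else 0) - p x) * u B +
         M (insert x B) * ((if x \<in> insert x B then 1 else 0) - p x) * u (insert x B)"
        by (simp add: u_def m algebra_simps)
    qed simp
    also have "\<dots> \<le> c x"
      by (rule insert.prems(2)) (auto simp: u_def sgn_if)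
    finally show ?thesis .
  qed
  have "(\<Sum>A\<in>Pow (insert x F). \<Sum>B\<in>Pow (insert x F). K A B * real (card (A - B \<union> (B - A))))
      = (\<Sum>A\<in>Pow F. \<Sum>B\<in>Pow F. K' A B * real (card (A - B \<union> (B - A))) + K' A B * \<bar>p x - r B\<bar>)"
    unfolding sum_Pow_insert[OF insert.hyps] sum.distrib[symmetric]
  proof (intro sum.cong refl)
    fix A B assume A: "A \<in> Pow F" and B: "B \<in> Pow F"
    have fin: "finite (A - B \<union> (B - A))"
      using A B insert.hyps by (auto intro: finite_subset)
    have absr: "\<bar>p x - r B\<bar> = p x + r B - 2 * min (p x) (r B)" by auto
    have "insert x A - B \<union> (B - insert x A) = insert x (A - B \<union> (B - A))"
         "A - insert x B \<union> (insert x B - A) = insert x (A - B \<union> (B - A))"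
         "insert x A - insert x B \<union> (insert x B - insert x A) = A - B \<union> (B - A)"
      using minus[OF A] minus[OF B] by auto
    moreover have "card (insert x (A - B \<union> (B - A))) = Suc (card (A - B \<union> (B - A)))"
      using minus[OF A] minus[OF B] fin by simp
    ultimately show "K A B * real (card (A - B \<union> (B - A))) +
           K A (insert x B) * real (card (A - insert x B \<union> (insert x B - A))) +
           (K (insert x A) B * real (card (insert x A - B \<union> (B - insert x A))) +
            K (insert x A) (insert x B) * real (card (insert x A - insert x B \<union> (insert x B - insert x A)))) =
           K' A B * real (card (A - B \<union> (B - A))) + K' A B * \<bar>p x - r B\<bar>"
      unfolding absr by (simp add: K_def minus[OF A] minus[OF B] J_def algebra_simps)
  qed
  also have "\<dots> \<le> (\<Sum>k\<in>F. c k) + c x"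
    using K'3 cost_x by (simp add: sum.distrib)
  finally have cost: "(\<Sum>A\<in>Pow (insert x F). \<Sum>B\<in>Pow (insert x F). K A B * real (card (A - B \<union> (B - A))))
      \<le> (\<Sum>k\<in>insert x F. c k)"
    using insert.hyps by simp
  have "0 \<le> K A B" for A B
    unfolding K_def by (intro mult_nonneg_nonneg K'0 J0)
  then show ?case
    using fst_marg snd_marg cost by (intro exI[of _ K]) blast
qed

text \<open>For each trace \<open>s\<close> on \<open>S\<close>, \<open>sequential_coupling\<close>
  is applied to \<open>w\<close> restricted to the sets with that trace. Toggling an element outside
  \<open>S\<close> keeps the trace, so its conditional mean is still \<open>\<phi>\<close> and it
  costs the error \<open>|\<phi> - q|\<close>. Elements of \<open>S\<close> are frozen by the
  conditioning and are charged the trivial cost 1.\<close>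

lemma conditional_coupling:
  fixes w :: "'a set \<Rightarrow> real" and \<phi> :: "'a \<Rightarrow> 'a set \<Rightarrow> real" and q :: "'a \<Rightarrow> 'a set \<Rightarrow> real"
  assumes fin: "finite E" and w0: "\<And>B. 0 \<le> w B"
    and gibbs: "\<And>k B. k \<in> E \<Longrightarrow> B \<subseteq> E \<Longrightarrow> k \<notin> B \<Longrightarrow> w (insert k B) * (1 - \<phi> k B) = w B * \<phi> k B"
    and \<phi>_insert: "\<And>k B. \<phi> k (insert k B) = \<phi> k (B - {k})"
    and q0: "\<And>k s. 0 \<le> q k s" and q1: "\<And>k s. q k s \<le> 1"
    and S: "S \<subseteq> E"
  shows "\<exists>K. (\<forall>s A B. 0 \<le> K s A B) \<and>
     (\<forall>s. \<forall>A\<in>Pow E. (\<Sum>B\<in>Pow E. K s A B) = (\<Sum>B\<in>Pow E. if B \<inter> S = s then w B else 0) *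
        (\<Prod>e\<in>E. if e \<in> A then q e s else 1 - q e s)) \<and>
     (\<forall>s. \<forall>B\<in>Pow E. (\<Sum>A\<in>Pow E. K s A B) = (if B \<inter> S = s then w B else 0)) \<and>
     (\<Sum>s\<in>Pow S. \<Sum>A\<in>Pow E. \<Sum>B\<in>Pow E. K s A B * real (card (A - B \<union> (B - A))))
        \<le> (\<Sum>B\<in>Pow E. w B * (real (card S) + (\<Sum>e\<in>E. \<bar>\<phi> e B - q e (B \<inter> S)\<bar>)))"
proof -
  define m where "m = (\<lambda>s B. if B \<inter> S = s then w B else 0)"
  have m0: "0 \<le> m s B" for s B using w0 by (simp add: m_def)
  define c where "c = (\<lambda>s k. \<Sum>B\<in>Pow E. m s B * (if k \<in> S then 1 else \<bar>\<phi> k B - q k s\<bar>))"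
  have test: "(\<Sum>B\<in>Pow E. m s B * ((if k \<in> B then 1 else 0) - q k s) * u B) \<le> c s k"
    if k: "k \<in> E" and u1: "\<And>B. \<bar>u B\<bar> \<le> 1" and u2: "\<And>B. u (insert k B) = u (B - {k})" for s k u
  proof (cases "k \<in> S")
    case True
    have "m s B * ((if k \<in> B then 1 else 0) - q k s) * u B \<le> m s B * 1" for B
    proof -
      have "((if k \<in> B then 1 else 0) - q k s) * u B \<le> \<bar>(if k \<in> B then 1 else 0) - q k s\<bar> * \<bar>u B\<bar>"
        by (metis abs_ge_self abs_mult)
      also have "\<dots> \<le> 1 * 1"
        using q0[of k s] q1[of k s] u1[of B] by (intro mult_mono) auto
      finally show ?thesis
        unfolding mult.assoc by (intro mult_left_mono m0) simp
    qed
    then show ?thesis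
      unfolding c_def using True by (intro sum_mono) simp
  next
    case False
    have E: "E = insert k (E - {k})" using k by auto
    \<comment> \<open>The sets \<open>B\<close> and \<open>insert k B\<close> are paired. Neither
      \<open>u\<close> nor \<open>\<phi> k\<close> distinguishes them, and \<open>gibbs\<close> says
      that their contributions cancel.\<close>
    have "(\<Sum>B\<in>Pow E. m s B * ((if k \<in> B then 1 else 0) - \<phi> k B) * u B) = 0"
    proof (subst E, subst sum_Pow_insert)
      show "(\<Sum>B\<in>Pow (E - {k}). m s B * ((if k \<in> B then 1 else 0) - \<phi> k B) * u B +
         m s (insert k B) * ((if k \<in> insert k B then 1 else 0) - \<phi> k (insert k B)) * u (insert k B)) = 0"
      proof (rule sum.neutral, rule ballI)
        fix B assume B: "B \<in> Pow (E - {k})"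
        then have kB: "k \<notin> B" "B - {k} = B" "B \<subseteq> E" by auto
        have mk: "m s (insert k B) * (1 - \<phi> k B) = m s B * \<phi> k B"
          using gibbs[OF k kB(3,1)] False by (simp add: m_def)
        have "m s B * (0 - \<phi> k B) * u B + m s (insert k B) * (1 - \<phi> k B) * u B = 0"
          unfolding mk by simp
        then show "m s B * ((if k \<in> B then 1 else 0) - \<phi> k B) * u B +
         m s (insert k B) * ((if k \<in> insert k B then 1 else 0) - \<phi> k (insert k B)) * u (insert k B) = 0"
          using kB u2[of B] \<phi>_insert[of k B] by simp
      qed
    qed (use fin in auto)
    then have "(\<Sum>B\<in>Pow E. m s B * ((if k \<in> B then 1 else 0) - q k s) * u B)
        = (\<Sum>B\<in>Pow E. m s B * ((if k \<in> B then 1 else 0) - q k s) * u B)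
          - (\<Sum>B\<in>Pow E. m s B * ((if k \<in> B then 1 else 0) - \<phi> k B) * u B)" by simp
    also have "\<dots> = (\<Sum>B\<in>Pow E. m s B * ((\<phi> k B - q k s) * u B))"
      unfolding sum_subtractf[symmetric] by (intro sum.cong) (auto simp: algebra_simps)
    also have "\<dots> \<le> (\<Sum>B\<in>Pow E. m s B * \<bar>\<phi> k B - q k s\<bar>)"
    proof (intro sum_mono mult_left_mono m0)
      fix B
      have "(\<phi> k B - q k s) * u B \<le> \<bar>\<phi> k B - q k s\<bar> * \<bar>u B\<bar>"
        by (metis abs_ge_self abs_mult)
      also have "\<dots> \<le> \<bar>\<phi> k B - q k s\<bar> * 1" using u1 by (intro mult_left_mono) auto
      finally show "(\<phi> k B - q k s) * u B \<le> \<bar>\<phi> k B - q k s\<bar>" by simp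
    qed
    finally show ?thesis using False by (simp add: c_def)
  qed
  have "\<forall>s. \<exists>K. (\<forall>A B. 0 \<le> K A B) \<and>
     (\<forall>A\<in>Pow E. (\<Sum>B\<in>Pow E. K A B) = (\<Sum>B\<in>Pow E. m s B) * (\<Prod>e\<in>E. if e \<in> A then q e s else 1 - q e s)) \<and>
     (\<forall>B\<in>Pow E. (\<Sum>A\<in>Pow E. K A B) = m s B) \<and>
     (\<Sum>A\<in>Pow E. \<Sum>B\<in>Pow E. K A B * real (card (A - B \<union> (B - A)))) \<le> (\<Sum>k\<in>E. c s k)"
    by (rule allI, rule sequential_coupling[OF fin q0 q1 m0 test])
  from choice[OF this] obtain K where K: "\<forall>s. (\<forall>A B. 0 \<le> K s A B) \<and>
     (\<forall>A\<in>Pow E. (\<Sum>B\<in>Pow E. K s A B) = (\<Sum>B\<in>Pow E. m s B) * (\<Prod>e\<in>E. if e \<in> A then q e s else 1 - q e s)) \<and>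
     (\<forall>B\<in>Pow E. (\<Sum>A\<in>Pow E. K s A B) = m s B) \<and>
     (\<Sum>A\<in>Pow E. \<Sum>B\<in>Pow E. K s A B * real (card (A - B \<union> (B - A)))) \<le> (\<Sum>k\<in>E. c s k)"
    by blast
  have finS: "finite (Pow S)" using S fin by (simp add: finite_subset)
  have "(\<Sum>s\<in>Pow S. \<Sum>A\<in>Pow E. \<Sum>B\<in>Pow E. K s A B * real (card (A - B \<union> (B - A))))
      \<le> (\<Sum>s\<in>Pow S. \<Sum>k\<in>E. c s k)"
    by (intro sum_mono) (use K in blast)
  also have "\<dots> = (\<Sum>s\<in>Pow S. \<Sum>B\<in>Pow E. \<Sum>k\<in>E. m s B * (if k \<in> S then 1 else \<bar>\<phi> k B - q k s\<bar>))"
    unfolding c_def by (rule sum.cong[OF refl], rule sum.swap)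
  also have "\<dots> = (\<Sum>B\<in>Pow E. \<Sum>s\<in>Pow S. \<Sum>k\<in>E. m s B * (if k \<in> S then 1 else \<bar>\<phi> k B - q k s\<bar>))"
    by (rule sum.swap)
  also have "\<dots> = (\<Sum>B\<in>Pow E. \<Sum>s\<in>Pow S. if B \<inter> S = s then
        w B * (\<Sum>k\<in>E. if k \<in> S then 1 else \<bar>\<phi> k B - q k s\<bar>) else 0)"
    by (intro sum.cong refl) (auto simp: m_def sum_distrib_left)
  also have "\<dots> = (\<Sum>B\<in>Pow E. w B * (\<Sum>k\<in>E. if k \<in> S then 1 else \<bar>\<phi> k B - q k (B \<inter> S)\<bar>))"
    using finS by (intro sum.cong refl) (simp add: sum.delta')
  also have "\<dots> \<le> (\<Sum>B\<in>Pow E. w B * (real (card S) + (\<Sum>e\<in>E. \<bar>\<phi> e B - q e (B \<inter> S)\<bar>)))"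
  proof (intro sum_mono mult_left_mono w0)
    fix B
    have "(\<Sum>k\<in>E. if k \<in> S then 1 else \<bar>\<phi> k B - q k (B \<inter> S)\<bar>)
        \<le> (\<Sum>k\<in>E. (if k \<in> S then 1 else 0) + \<bar>\<phi> k B - q k (B \<inter> S)\<bar>)"
      by (intro sum_mono) auto
    also have "\<dots> = real (card S) + (\<Sum>e\<in>E. \<bar>\<phi> e B - q e (B \<inter> S)\<bar>)"
      using S fin by (simp add: sum.distrib sum.If_cases Int_absorb1)
    finally show "(\<Sum>k\<in>E. if k \<in> S then 1 else \<bar>\<phi> k B - q k (B \<inter> S)\<bar>)
        \<le> real (card S) + (\<Sum>e\<in>E. \<bar>\<phi> e B - q e (B \<inter> S)\<bar>)" .
  qed
  finally show ?thesis
    using K by (intro exI[of _ K]) (simp add: m_def)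
qed

section \<open>Empirical approximation\<close>

text \<open>Maurey's empirical method, derandomised: in each step some sample (or the zero vector, of
  weight \<open>1 - sum wt Z\<close>) does not exceed the average of the potential.\<close>

lemma empirical_approximation:
  fixes v :: "'z \<Rightarrow> 'o \<Rightarrow> real" and wt cost :: "'z \<Rightarrow> real" and m D :: "'o \<Rightarrow> real"
  assumes finZ: "finite Z"
    and wt0: "\<And>z. z \<in> Z \<Longrightarrow> 0 \<le> wt z" and wt1: "(\<Sum>z\<in>Z. wt z) \<le> 1"
    and m0: "\<And>x. x \<in> \<Omega> \<Longrightarrow> 0 \<le> m x"
    and D: "\<And>x. x \<in> \<Omega> \<Longrightarrow> D x = (\<Sum>z\<in>Z. wt z * v z x)"
    and v: "\<And>z x. z \<in> Z \<Longrightarrow> x \<in> \<Omega> \<Longrightarrow> \<bar>v z x\<bar> \<le> b"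
  shows "\<exists>zs. length zs \<le> n \<and> set zs \<subseteq> Z \<and>
     (\<Sum>x\<in>\<Omega>. m x * ((\<Sum>z\<leftarrow>zs. v z x) - real n * D x)\<^sup>2) + l * (\<Sum>z\<leftarrow>zs. cost z)
       \<le> real n * (b\<^sup>2 * (\<Sum>x\<in>\<Omega>. m x) + l * (\<Sum>z\<in>Z. wt z * cost z))"
proof (induction n)
  case 0
  then show ?case by (intro exI[of _ "[]"]) simp
next
  case (Suc n)
  then obtain zs where zs: "length zs \<le> n" "set zs \<subseteq> Z" and
     le: "(\<Sum>x\<in>\<Omega>. m x * ((\<Sum>z\<leftarrow>zs. v z x) - real n * D x)\<^sup>2) + l * (\<Sum>z\<leftarrow>zs. cost z)
       \<le> real n * (b\<^sup>2 * (\<Sum>x\<in>\<Omega>. m x) + l * (\<Sum>z\<in>Z. wt z * cost z))" by blast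
  define R where "R = (\<lambda>x. (\<Sum>z\<leftarrow>zs. v z x) - real n * D x)"
  define \<Phi> where "\<Phi> = (\<lambda>g. \<Sum>x\<in>\<Omega>. m x * (g x)\<^sup>2)"
  define T where "T = \<Phi> R + b\<^sup>2 * (\<Sum>x\<in>\<Omega>. m x) + l * (\<Sum>z\<in>Z. wt z * cost z)"
  define W where "W = (\<Sum>z\<in>Z. wt z)"
  \<comment> \<open>The new vector, counting the zero vector, has mean \<open>D\<close>, so the
    cross term cancels and the expected square grows by at most \<open>b\<^sup>2\<close>.\<close>
  have avg: "(\<Sum>z\<in>Z. wt z * (\<Phi> (\<lambda>x. R x + v z x - D x) + l * cost z)) + (1 - W) * \<Phi> (\<lambda>x. R x - D x) \<le> T"
  proof -
    have pt: "(\<Sum>z\<in>Z. wt z * (R x + v z x - D x)\<^sup>2) + (1 - W) * (R x - D x)\<^sup>2 \<le> (R x)\<^sup>2 + b\<^sup>2"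
      if x: "x \<in> \<Omega>" for x
    proof -
      have "(\<Sum>z\<in>Z. wt z * (R x + v z x - D x)\<^sup>2)
          = (\<Sum>z\<in>Z. wt z * (R x - D x)\<^sup>2 + 2 * (R x - D x) * (wt z * v z x) + wt z * (v z x)\<^sup>2)"
        by (intro sum.cong refl) (simp add: power2_eq_square algebra_simps)
      also have "\<dots> = W * (R x - D x)\<^sup>2 + 2 * (R x - D x) * D x + (\<Sum>z\<in>Z. wt z * (v z x)\<^sup>2)"
        by (simp add: sum.distrib W_def D[OF x] sum_distrib_left sum_distrib_right)
      finally have "(\<Sum>z\<in>Z. wt z * (R x + v z x - D x)\<^sup>2) + (1 - W) * (R x - D x)\<^sup>2
          = (R x)\<^sup>2 - (D x)\<^sup>2 + (\<Sum>z\<in>Z. wt z * (v z x)\<^sup>2)"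
        by (simp add: power2_eq_square algebra_simps)
      moreover have "(\<Sum>z\<in>Z. wt z * (v z x)\<^sup>2) \<le> (\<Sum>z\<in>Z. wt z * b\<^sup>2)"
      proof (intro sum_mono mult_left_mono wt0)
        fix z assume "z \<in> Z"
        then have "\<bar>v z x\<bar> \<le> \<bar>b\<bar>" using v[OF _ x, of z] by linarith
        then show "(v z x)\<^sup>2 \<le> b\<^sup>2" by (simp add: abs_le_square_iff)
      qed
      moreover have "(\<Sum>z\<in>Z. wt z * b\<^sup>2) \<le> 1 * b\<^sup>2"
        unfolding sum_distrib_right[symmetric] by (intro mult_right_mono wt1) simp
      ultimately show ?thesis using zero_le_power2[of "D x"] by linarith
    qed
    have "(\<Sum>z\<in>Z. wt z * \<Phi> (\<lambda>x. R x + v z x - D x)) + (1 - W) * \<Phi> (\<lambda>x. R x - D x)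
        = (\<Sum>x\<in>\<Omega>. m x * ((\<Sum>z\<in>Z. wt z * (R x + v z x - D x)\<^sup>2) + (1 - W) * (R x - D x)\<^sup>2))"
      unfolding \<Phi>_def sum_distrib_left distrib_left sum.distrib
      by (subst sum.swap) (simp add: mult_ac)
    also have "\<dots> \<le> (\<Sum>x\<in>\<Omega>. m x * ((R x)\<^sup>2 + b\<^sup>2))"
      by (intro sum_mono mult_left_mono pt m0)
    also have "\<dots> = \<Phi> R + b\<^sup>2 * (\<Sum>x\<in>\<Omega>. m x)"
      by (simp add: \<Phi>_def distrib_left sum.distrib sum_distrib_right mult.commute[of "b\<^sup>2"])
    finally show ?thesis
      by (simp add: T_def distrib_left sum.distrib sum_distrib_left mult_ac)
  qed
  have "(\<exists>z\<in>Z. \<Phi> (\<lambda>x. R x + v z x - D x) + l * cost z \<le> T) \<or> \<Phi> (\<lambda>x. R x - D x) \<le> T"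
  proof (rule ccontr)
    assume "\<not> ?thesis"
    then have big: "\<And>z. z \<in> Z \<Longrightarrow> T < \<Phi> (\<lambda>x. R x + v z x - D x) + l * cost z" "T < \<Phi> (\<lambda>x. R x - D x)"
      by (auto simp: not_le)
    \<comment> \<open>Strictness needs an outcome of positive weight: some \<open>z\<close> if the
      zero vector has weight 0, and otherwise the zero vector itself.\<close>
    have "T * W + (1 - W) * T < (\<Sum>z\<in>Z. wt z * (\<Phi> (\<lambda>x. R x + v z x - D x) + l * cost z)) + (1 - W) * \<Phi> (\<lambda>x. R x - D x)"
    proof (cases "W = 1")
      case True
      then obtain z where z: "z \<in> Z" "wt z \<noteq> 0"
        unfolding W_def by (metis sum.neutral zero_neq_one)
      have "(\<Sum>z\<in>Z. wt z * T) < (\<Sum>z\<in>Z. wt z * (\<Phi> (\<lambda>x. R x + v z x - D x) + l * cost z))"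
      proof (rule sum_strict_mono_ex1[OF finZ])
        show "\<forall>z\<in>Z. wt z * T \<le> wt z * (\<Phi> (\<lambda>x. R x + v z x - D x) + l * cost z)"
          using big wt0 by (intro ballI mult_left_mono) (simp_all add: less_imp_le)
        have "wt z > 0" using z wt0[of z] by simp
        then show "\<exists>z\<in>Z. wt z * T < wt z * (\<Phi> (\<lambda>x. R x + v z x - D x) + l * cost z)"
          using big(1)[of z] z(1) by (intro bexI[of _ z]) simp_all
      qed
      then show ?thesis using True
        by (simp add: W_def flip: sum_distrib_right)
    next
      case False
      then have "W < 1" using wt1 by (simp add: W_def)
      then have "(1 - W) * T < (1 - W) * \<Phi> (\<lambda>x. R x - D x)" using big by simp
      moreover have "(\<Sum>z\<in>Z. wt z * T) \<le> (\<Sum>z\<in>Z. wt z * (\<Phi> (\<lambda>x. R x + v z x - D x) + l * cost z))"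
        using big wt0 by (intro sum_mono mult_left_mono) (auto simp: less_imp_le)
      moreover have "(\<Sum>z\<in>Z. wt z * T) = T * W"
        by (simp add: W_def sum_distrib_left mult.commute)
      ultimately show ?thesis by linarith
    qed
    moreover have "T * W + (1 - W) * T = T" by (simp add: algebra_simps)
    ultimately show False using avg by linarith
  qed
  then obtain zs' where zs': "length zs' \<le> Suc n" "set zs' \<subseteq> Z"
    "\<Phi> (\<lambda>x. (\<Sum>z\<leftarrow>zs'. v z x) - real (Suc n) * D x) + l * (\<Sum>z\<leftarrow>zs'. cost z)
       \<le> T + l * (\<Sum>z\<leftarrow>zs. cost z)"
  proof (elim disjE bexE)
    fix z assume z: "z \<in> Z" and le: "\<Phi> (\<lambda>x. R x + v z x - D x) + l * cost z \<le> T"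
    have "(\<lambda>x. (\<Sum>z\<leftarrow>z # zs. v z x) - real (Suc n) * D x) = (\<lambda>x. R x + v z x - D x)"
      by (simp add: R_def algebra_simps fun_eq_iff)
    then show ?thesis using zs z le
      by (intro that[of "z # zs"]) (simp_all add: distrib_left del: of_nat_Suc)
  next
    \<comment> \<open>The zero vector was chosen: \<open>n\<close> grows but the list does not,
      which is why its length is only bounded by \<open>n\<close>.\<close>
    assume le: "\<Phi> (\<lambda>x. R x - D x) \<le> T"
    have "(\<lambda>x. (\<Sum>z\<leftarrow>zs. v z x) - real (Suc n) * D x) = (\<lambda>x. R x - D x)"
      by (simp add: R_def algebra_simps fun_eq_iff)
    then show ?thesis using zs le
      by (intro that[of zs]) (simp_all del: of_nat_Suc)
  qed
  have "T + l * (\<Sum>z\<leftarrow>zs. cost z)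
      \<le> real (Suc n) * (b\<^sup>2 * (\<Sum>x\<in>\<Omega>. m x) + l * (\<Sum>z\<in>Z. wt z * cost z))"
    using le unfolding T_def \<Phi>_def R_def of_nat_Suc distrib_right[of "1::real"] mult_1 by linarith
  from order_trans[OF zs'(3) this] zs'(1,2) show ?case
    unfolding \<Phi>_def by blast
qed

section \<open>Discrete derivatives of subgraph counts\<close>

abbreviation verts :: "((nat \<times> (nat \<times> nat) set) \<times> real) list \<Rightarrow> nat \<Rightarrow> nat" where
  "verts Hs h \<equiv> fst (fst (Hs ! h))"
abbreviation edges :: "((nat \<times> (nat \<times> nat) set) \<times> real) list \<Rightarrow> nat \<Rightarrow> (nat \<times> nat) set" where
  "edges Hs h \<equiv> snd (fst (Hs ! h))"
abbreviation weight :: "((nat \<times> (nat \<times> nat) set) \<times> real) list \<Rightarrow> nat \<Rightarrow> real" where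
  "weight Hs h \<equiv> snd (Hs ! h)"

definition injmaps :: "nat \<Rightarrow> nat \<Rightarrow> (nat \<Rightarrow> nat) set" where
  "injmaps m N = {q \<in> {0..<m} \<rightarrow>\<^sub>E {0..<N}. inj_on q {0..<m}}"

definition edge_product :: "((nat \<times> nat) \<Rightarrow> real) \<Rightarrow> (nat \<times> nat) set \<Rightarrow> (nat \<Rightarrow> nat) \<Rightarrow> real" where
  "edge_product X T q = (\<Prod>(l,l')\<in>T. entry X (q l) (q l'))"

text \<open>The falling factorial. For \<open>m > N\<close> the factor \<open>k = N\<close> makes it
  0, and quotients by it are then 0 by convention.\<close>

definition falling :: "nat \<Rightarrow> nat \<Rightarrow> real" where
  "falling N m = (\<Prod>k<m. (real N - real k))"

text \<open>For \<open>x \<noteq> y\<close> and \<open>i \<noteq> j\<close> this permutation maps \<open>x\<close> to \<open>i\<close> and \<open>y\<close> to \<open>j\<close>; composing with it turns a uniform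
  injection into a uniform injection with prescribed values at two vertices.\<close>

definition relocate :: "nat \<Rightarrow> nat \<Rightarrow> nat \<Rightarrow> nat \<Rightarrow> nat \<Rightarrow> nat" where
  "relocate x y i j = Transposition.transpose (Transposition.transpose x i y) j \<circ> Transposition.transpose x i"

text \<open>The third part holds because a vertex other than \<open>x\<close> and \<open>y\<close>
  moves only if it is \<open>i\<close> or \<open>j\<close>, and then it fills one of the places left
  by \<open>x\<close> and \<open>y\<close>.\<close>

lemma relocate_apply:
  assumes "x \<noteq> y" "i \<noteq> j"
  shows "relocate x y i j x = i" "relocate x y i j y = j"
    and "v \<noteq> x \<Longrightarrow> v \<noteq> y \<Longrightarrow> relocate x y i j v \<in> {v, x, y}"
  using assms by (auto simp: relocate_def Transposition.transpose_def)

lemma relocate_less: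
  assumes "x < N" "y < N" "i < N" "j < N" "v < N"
  shows "relocate x y i j v < N"
  using assms by (auto simp: relocate_def Transposition.transpose_def)

section \<open>Injective placements of a graph and their number\<close>

lemma finite_injmaps [simp]: "finite (injmaps m N)"
  unfolding injmaps_def by (rule finite_subset[of _ "{0..<m} \<rightarrow>\<^sub>E {0..<N}"]) (auto intro: finite_PiE)

lemma injmapsD:
  assumes "q \<in> injmaps m N"
  shows "l < m \<Longrightarrow> q l < N" "l < m \<Longrightarrow> l' < m \<Longrightarrow> q l = q l' \<longleftrightarrow> l = l'"
  using assms by (auto simp: injmaps_def inj_on_def PiE_iff)

lemma card_injmaps: "real (card (injmaps m N)) = falling N m"
proof -
  have "card (injmaps m N) = prod ((-) N) {0..<m}"
    using card_inj_on_subset_funcset[of "{0..<m}" "{0..<N}" "{0..<m}"] by (simp add: injmaps_def)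
  also have "real \<dots> = falling N m"
  proof (cases "m \<le> N")
    case True
    then show ?thesis unfolding falling_def
      by (auto simp: atLeast0LessThan of_nat_diff intro!: prod.cong)
  next
    case False
    then have "prod ((-) N) {0..<m} = 0" "falling N m = 0"
      unfolding falling_def by (auto intro!: prod_zero bexI[of _ N])
    then show ?thesis by simp
  qed
  finally show ?thesis .
qed

lemma falling_nonneg: "0 \<le> falling N m"
  unfolding card_injmaps[symmetric] by simp

lemma edge_product_cong:
  assumes "T \<subseteq> {(a,b). a < b \<and> b < m}" "\<And>l. l < m \<Longrightarrow> q l = q' l"
  shows "edge_product X T q = edge_product X T q'"
  unfolding edge_product_def
proof (rule prod.cong[OF refl])
  fix e assume "e \<in> T"
  then obtain l l' where "e = (l, l')" "l < m" "l' < m" using assms(1) by auto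
  then show "(case e of (l, l') \<Rightarrow> entry X (q l) (q l')) = (case e of (l, l') \<Rightarrow> entry X (q' l) (q' l'))"
    by (simp add: assms(2)[of l] assms(2)[of l'])
qed

lemma restrict_comp_injmaps:
  assumes "inj \<pi>" "\<And>x. x < N \<Longrightarrow> \<pi> x < N" "q \<in> injmaps m N"
  shows "restrict (\<pi> \<circ> q) {0..<m} \<in> injmaps m N"
proof -
  have "inj_on q {0..<m}" and q: "q \<in> {0..<m} \<rightarrow> {0..<N}"
    using assms(3) by (auto simp: injmaps_def)
  then have "inj_on (\<pi> \<circ> q) {0..<m}"
    using inj_on_subset[OF assms(1)] by (intro comp_inj_on) auto
  then show ?thesis
    using q assms(2) by (auto simp: injmaps_def Pi_iff)
qed

section \<open>Ordered pairs of vertices, and the image of a pair under a uniform injection\<close>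

definition offdiag :: "nat \<Rightarrow> (nat \<times> nat) set" where
  "offdiag N = {(x,y). x < N \<and> y < N \<and> x \<noteq> y}"

lemma finite_offdiag [simp]: "finite (offdiag N)"
  unfolding offdiag_def by (rule finite_subset[of _ "{..<N} \<times> {..<N}"]) auto

lemma finite_edge_set [simp]: "finite (edge_set N)"
  by (rule finite_subset[OF _ finite_offdiag[of N]]) (auto simp: edge_set_def offdiag_def)

lemma offdiag_eq: "offdiag N = edge_set N \<union> prod.swap ` edge_set N"
  by (force simp: offdiag_def edge_set_def)

lemma sum_offdiag_symmetric:
  fixes g :: "nat \<times> nat \<Rightarrow> real"
  assumes "\<And>x y. g (x, y) = g (y, x)"
  shows "sum g (offdiag N) = 2 * sum g (edge_set N)"
proof -
  have "sum g (offdiag N) = sum g (edge_set N) + sum g (prod.swap ` edge_set N)"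
    unfolding offdiag_eq
  proof (rule sum.union_disjoint)
    show "edge_set N \<inter> prod.swap ` edge_set N = {}" by (auto simp: edge_set_def)
  qed simp_all
  also have "sum g (prod.swap ` edge_set N) = sum g (edge_set N)"
    by (subst sum.reindex) (auto intro!: sum.cong simp: inj_on_def assms)
  finally show ?thesis by simp
qed

lemma card_edge_set: "card (edge_set N) = N choose 2"
proof (induction N)
  case (Suc N)
  have "edge_set (Suc N) = edge_set N \<union> (\<lambda>i. (i, N)) ` {..<N}"
    by (auto simp: edge_set_def less_Suc_eq)
  moreover have "card (edge_set N \<union> (\<lambda>i. (i, N)) ` {..<N}) = card (edge_set N) + card ((\<lambda>i. (i, N)) ` {..<N})"
    by (rule card_Un_disjoint[OF finite_edge_set]) (auto simp: edge_set_def)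
  moreover have "card ((\<lambda>i. (i, N)) ` {..<N}) = N"
    by (subst card_image) (auto simp: inj_on_def)
  ultimately show ?case using Suc by (simp add: numeral_2_eq_2)
qed (simp add: edge_set_def numeral_2_eq_2)

lemma card_offdiag: "real (card (offdiag N)) = real N * (real N - 1)"
proof -
  have "real (card (offdiag N)) = 2 * real (N choose 2)"
    using sum_offdiag_symmetric[of "\<lambda>_. 1" N] by (simp add: card_edge_set)
  also have "\<dots> = real N * (real N - 1)"
  proof -
    have "2 * (N choose 2) = N * (N - 1)"
      unfolding choose_two by (rule dvd_mult_div_cancel) (cases N, auto)
    then have "real (2 * (N choose 2)) = real (N * (N - 1))" by (rule arg_cong)
    then show ?thesis by (cases N) (simp_all add: algebra_simps)
  qed
  finally show ?thesis .
qed

text \<open>Composition with the permutation \<open>relocate x y i j\<close> is a bijection between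
  the two fibres. Elements of \<open>injmaps\<close> are extensional, so the composite must be
  restricted to \<open>{0..<m}\<close>; the hypothesis on \<open>F\<close> makes this restriction
  invisible.\<close>

lemma sum_relocate_fiber:
  assumes ab: "a < m" "b < m" "a \<noteq> b" and xy: "(x, y) \<in> offdiag N" and ij: "(i, j) \<in> offdiag N"
    and F: "\<And>q q'. (\<And>l. l < m \<Longrightarrow> q l = q' l) \<Longrightarrow> F q = F q'"
  shows "(\<Sum>q | q \<in> injmaps m N \<and> (q a, q b) = (x, y). F (relocate x y i j \<circ> q))
       = (\<Sum>q | q \<in> injmaps m N \<and> (q a, q b) = (i, j). F q :: real)"
proof -
  define \<pi>' where "\<pi>' = Transposition.transpose x i \<circ> Transposition.transpose (Transposition.transpose x i y) j"
  have inv: "\<pi>' (relocate x y i j v) = v" "relocate x y i j (\<pi>' v) = v" for v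
    by (simp_all add: \<pi>'_def relocate_def)
  have inj: "inj (relocate x y i j)" "inj \<pi>'"
    by (rule inj_on_inverseI[of _ \<pi>'], simp add: inv, rule inj_on_inverseI[of _ "relocate x y i j"], simp add: inv)
  have less: "v < N \<Longrightarrow> \<pi>' v < N" "v < N \<Longrightarrow> relocate x y i j v < N" for v
    using xy ij by (auto simp: \<pi>'_def offdiag_def relocate_less Transposition.transpose_def)
  have r: "relocate x y i j x = i" "relocate x y i j y = j"
    using relocate_apply[of x y i j] xy ij by (auto simp: offdiag_def)
  have r': "\<pi>' i = x" "\<pi>' j = y" using inv(1)[of x] inv(1)[of y] by (simp_all only: r)
  have ext': "restrict (f \<circ> restrict (g \<circ> q) {0..<m}) {0..<m} = q"
    if "\<And>v. f (g v) = v" "q \<in> injmaps m N" for f g :: "nat \<Rightarrow> nat" and q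
    using that by (auto simp: fun_eq_iff injmaps_def PiE_iff extensional_def)
  show ?thesis
  proof (rule sum.reindex_bij_witness[where
        i = "\<lambda>q. restrict (\<pi>' \<circ> q) {0..<m}" and j = "\<lambda>q. restrict (relocate x y i j \<circ> q) {0..<m}"])
    fix q assume q: "q \<in> {q \<in> injmaps m N. (q a, q b) = (x, y)}"
    show "restrict (\<pi>' \<circ> restrict (relocate x y i j \<circ> q) {0..<m}) {0..<m} = q"
      by (rule ext'[where f = \<pi>' and g = "relocate x y i j", OF inv(1)]) (use q in simp)
    show "restrict (relocate x y i j \<circ> q) {0..<m} \<in> {q \<in> injmaps m N. (q a, q b) = (i, j)}"
      using q r ab restrict_comp_injmaps[OF inj(1) less(2)] by simp
    show "F (restrict (relocate x y i j \<circ> q) {0..<m}) = F (relocate x y i j \<circ> q)"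
      by (rule F) simp
  next
    fix q assume q: "q \<in> {q \<in> injmaps m N. (q a, q b) = (i, j)}"
    show "restrict (relocate x y i j \<circ> restrict (\<pi>' \<circ> q) {0..<m}) {0..<m} = q"
      by (rule ext'[where g = \<pi>' and f = "relocate x y i j", OF inv(2)]) (use q in simp)
    show "restrict (\<pi>' \<circ> q) {0..<m} \<in> {q \<in> injmaps m N. (q a, q b) = (x, y)}"
      using q r' ab restrict_comp_injmaps[OF inj(2) less(1)] by simp
  qed
qed

lemma injmaps_offdiag:
  assumes "a < m" "b < m" "a \<noteq> b" "q \<in> injmaps m N"
  shows "(q a, q b) \<in> offdiag N"
  using assms injmapsD[OF assms(4)] by (auto simp: offdiag_def)

text \<open>The injections are split by the ordered pair at \<open>(a, b)\<close>; all
  \<open>N * (N - 1)\<close> fibres give the same sum. A sum constrained to hit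
  \<open>(i, j)\<close> thus becomes a sum over free injections, which can be sampled without
  knowing \<open>(i, j)\<close>.\<close>

lemma sum_relocate:
  assumes ab: "a < m" "b < m" "a \<noteq> b" and ij: "(i, j) \<in> offdiag N"
    and F: "\<And>q q'. (\<And>l. l < m \<Longrightarrow> q l = q' l) \<Longrightarrow> F q = F q'"
  shows "(\<Sum>q\<in>injmaps m N. F (relocate (q a) (q b) i j \<circ> q))
       = real N * (real N - 1) * (\<Sum>q | q \<in> injmaps m N \<and> (q a, q b) = (i, j). F q)"
proof -
  have "(\<Sum>q\<in>injmaps m N. F (relocate (q a) (q b) i j \<circ> q))
      = (\<Sum>xy\<in>offdiag N. \<Sum>q | q \<in> injmaps m N \<and> (q a, q b) = xy. F (relocate (q a) (q b) i j \<circ> q))"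
    by (rule sum.group[symmetric]) (use injmaps_offdiag[OF ab] in auto)
  also have "\<dots> = (\<Sum>xy\<in>offdiag N. \<Sum>q | q \<in> injmaps m N \<and> (q a, q b) = (i, j). F q)"
  proof (rule sum.cong[OF refl])
    fix xy assume xy: "xy \<in> offdiag N"
    obtain x y where [simp]: "xy = (x, y)" by (cases xy)
    have "(\<Sum>q | q \<in> injmaps m N \<and> (q a, q b) = (x, y). F (relocate (q a) (q b) i j \<circ> q))
        = (\<Sum>q | q \<in> injmaps m N \<and> (q a, q b) = (x, y). F (relocate x y i j \<circ> q))"
      by (rule sum.cong) auto
    also have "\<dots> = (\<Sum>q | q \<in> injmaps m N \<and> (q a, q b) = (i, j). F q)"
    proof (rule sum_relocate_fiber[OF ab _ ij])
      show "(x, y) \<in> offdiag N" using xy by simp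
      show "F q = F q'" if "\<And>l. l < m \<Longrightarrow> q l = q' l" for q q'
        by (rule F) (rule that)
    qed
    finally show "(\<Sum>q | q \<in> injmaps m N \<and> (q a, q b) = xy. F (relocate (q a) (q b) i j \<circ> q))
      = (\<Sum>q | q \<in> injmaps m N \<and> (q a, q b) = (i, j). F q)" by simp
  qed
  also have "\<dots> = real N * (real N - 1) * (\<Sum>q | q \<in> injmaps m N \<and> (q a, q b) = (i, j). F q)"
    by (simp add: card_offdiag)
  finally show ?thesis .
qed

text \<open>Two distinct vertices have a uniform image in \<open>offdiag N\<close>. The common fibre
  size comes from \<open>sum_relocate\<close> with a constant function.\<close>

lemma sum_injmaps_pair:
  assumes ab: "a < m" "b < m" "a \<noteq> b"
  shows "real N * (real N - 1) * (\<Sum>q\<in>injmaps m N. g (q a, q b)) = falling N m * sum g (offdiag N)"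
proof -
  have c: "real N * (real N - 1) * (\<Sum>q | q \<in> injmaps m N \<and> (q a, q b) = ij. g (q a, q b)) = falling N m * g ij"
    if "ij \<in> offdiag N" for ij
  proof -
    obtain i j where [simp]: "ij = (i, j)" by (cases ij)
    have "(\<Sum>q | q \<in> injmaps m N \<and> (q a, q b) = ij. g (q a, q b))
        = (\<Sum>q | q \<in> injmaps m N \<and> (q a, q b) = ij. 1) * g ij"
      unfolding sum_distrib_right by (rule sum.cong) auto
    moreover have "real N * (real N - 1) * (\<Sum>q | q \<in> injmaps m N \<and> (q a, q b) = (i, j). 1) = falling N m"
      using sum_relocate[OF ab, of i j N "\<lambda>_. 1"] that by (simp add: card_injmaps)
    ultimately show ?thesis by (simp only: \<open>ij = (i, j)\<close> mult.assoc[symmetric])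
  qed
  have "(\<Sum>q\<in>injmaps m N. g (q a, q b))
      = (\<Sum>ij\<in>offdiag N. \<Sum>q | q \<in> injmaps m N \<and> (q a, q b) = ij. g (q a, q b))"
    by (rule sum.group[symmetric]) (use injmaps_offdiag[OF ab] in auto)
  then have "real N * (real N - 1) * (\<Sum>q\<in>injmaps m N. g (q a, q b))
      = (\<Sum>ij\<in>offdiag N. real N * (real N - 1) *
          (\<Sum>q | q \<in> injmaps m N \<and> (q a, q b) = ij. g (q a, q b)))"
    by (simp only: sum_distrib_left[of _ _ "offdiag N"])
  also have "\<dots> = (\<Sum>ij\<in>offdiag N. falling N m * g ij)"
    by (intro sum.cong refl c)
  finally show ?thesis by (simp add: sum_distrib_left)
qed

section \<open>Formulas for the discrete derivative\<close>

lemma entry_upd: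
  assumes "i < j"
  shows "entry (X((i,j) := c)) x y = (if (x = i \<and> y = j) \<or> (x = j \<and> y = i) then c else entry X x y)"
  using assms by (auto simp: entry_def)

text \<open>The edge \<open>{i,j}\<close> is unordered, so an edge of the graph can be laid on it in
  two orientations.\<close>

definition hits :: "(nat \<Rightarrow> nat) \<Rightarrow> nat \<times> nat \<Rightarrow> nat \<times> nat \<Rightarrow> bool" where
  "hits q ab ij \<longleftrightarrow> (q (fst ab), q (snd ab)) = ij \<or> (q (fst ab), q (snd ab)) = prod.swap ij"

text \<open>An injection lays at most one edge of \<open>T\<close> on \<open>{i,j}\<close>, so the
  product is affine in that coordinate. Its slope is the product over the remaining edges, and the
  sum on the right has at most one nonzero term.\<close>

lemma edge_product_diff:
  assumes T: "T \<subseteq> {(a,b). a < b \<and> b < m}" and q: "q \<in> injmaps m N" and ij: "i < j"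
  shows "edge_product (X((i,j) := 1)) T q - edge_product (X((i,j) := 0)) T q =
     (\<Sum>ab\<in>T. if hits q ab (i,j) then edge_product X (T - {ab}) q else 0)"
proof -
  have fin: "finite T"
    by (rule finite_subset[OF T]) (rule finite_subset[of _ "{..<m} \<times> {..<m}"], auto)
  have ep: "edge_product (X((i,j) := c)) T' q = (\<Prod>cd\<in>T'. if hits q cd (i,j) then c else
      entry X (q (fst cd)) (q (snd cd)))" for c T'
    unfolding edge_product_def hits_def
    by (intro prod.cong refl) (use ij in \<open>auto simp: entry_upd\<close>)
  have ep': "edge_product X T' q = (\<Prod>cd\<in>T'. entry X (q (fst cd)) (q (snd cd)))" for T'
    unfolding edge_product_def by (intro prod.cong refl) auto
  show ?thesis
  proof (cases "\<exists>ab\<in>T. hits q ab (i,j)")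
    case False
    then show ?thesis by (simp add: ep cong: prod.cong)
  next
    case True
    then obtain ab where ab: "ab \<in> T" "hits q ab (i,j)" by blast
    \<comment> \<open>Injectivity of \<open>q\<close> leaves equality or reversal of the two pairs;
      reversal contradicts \<open>a < b\<close> and \<open>c < d\<close>.\<close>
    have uniq: "cd = ab" if "cd \<in> T" "hits q cd (i,j)" for cd
    proof -
      obtain a b c d where [simp]: "ab = (a, b)" "cd = (c, d)" by (metis surj_pair)
      have "a < b" "b < m" "c < d" "d < m"
        using that(1) ab(1) T by auto
      then have "(q c = q a) = (c = a)" "(q d = q b) = (d = b)" "(q c = q b) = (c = b)" "(q d = q a) = (d = a)"
        using injmapsD(2)[OF q] by auto
      moreover have "q c = q a \<and> q d = q b \<or> q c = q b \<and> q d = q a"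
        using that(2) ab(2) by (auto simp: hits_def)
      ultimately show ?thesis using \<open>a < b\<close> \<open>c < d\<close> by auto
    qed
    then have no: "\<not> hits q cd (i,j)" if "cd \<in> T" "cd \<noteq> ab" for cd
      using that by blast
    have rest: "(\<Prod>cd\<in>T - {ab}. if hits q cd (i,j) then c else entry X (q (fst cd)) (q (snd cd)))
        = edge_product X (T - {ab}) q" for c
      unfolding ep' by (intro prod.cong) (use no in auto)
    have "edge_product (X((i,j) := c)) T q = c * edge_product X (T - {ab}) q" for c
      unfolding ep by (subst prod.remove[OF fin ab(1)], subst rest) (use ab in simp)
    moreover have "(\<Sum>ab'\<in>T. if hits q ab' (i,j) then edge_product X (T - {ab'}) q else 0)
        = edge_product X (T - {ab}) q"
      by (subst sum.remove[OF fin ab(1)]) (use no ab in \<open>auto intro!: sum.neutral\<close>)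
    ultimately show ?thesis by simp
  qed
qed

lemma subgraph_fun_alt:
  "subgraph_fun N Hs X = (\<Sum>h<length Hs. real N * (real N - 1) * weight Hs h / falling N (verts Hs h) *
     (\<Sum>q\<in>injmaps (verts Hs h) N. edge_product X (edges Hs h) q))"
  unfolding subgraph_fun_def hom_density_def injmaps_def edge_product_def falling_def
  by (simp add: sum_distrib_left sum_divide_distrib mult_ac)

lemma pdiff_subgraph_fun:
  assumes H: "\<forall>h\<in>set Hs. simple_graph (fst h)" and ij: "i < j"
  shows "pdiff (subgraph_fun N Hs) (i,j) X =
    (\<Sum>h<length Hs. real N * (real N - 1) * weight Hs h / (2 * falling N (verts Hs h)) *
      (\<Sum>ab\<in>edges Hs h. \<Sum>q\<in>injmaps (verts Hs h) N.
        if hits q ab (i,j) then edge_product X (edges Hs h - {ab}) q else 0))"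
proof -
  have *: "(\<Sum>q\<in>injmaps (verts Hs h) N. edge_product (X((i,j):=1)) (edges Hs h) q) -
        (\<Sum>q\<in>injmaps (verts Hs h) N. edge_product (X((i,j):=0)) (edges Hs h) q)
      = (\<Sum>ab\<in>edges Hs h. \<Sum>q\<in>injmaps (verts Hs h) N.
        if hits q ab (i,j) then edge_product X (edges Hs h - {ab}) q else 0)"
    if "h < length Hs" for h
  proof -
    have T: "edges Hs h \<subseteq> {(a,b). a < b \<and> b < verts Hs h}"
      using H that by (auto simp: simple_graph_def)
    show ?thesis
      unfolding sum_subtractf[symmetric]
      by (subst sum.swap, rule sum.cong[OF refl], rule edge_product_diff[OF T _ ij])
  qed
  have "pdiff (subgraph_fun N Hs) (i,j) X =
    (\<Sum>h<length Hs. real N * (real N - 1) * weight Hs h / (2 * falling N (verts Hs h)) *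
      ((\<Sum>q\<in>injmaps (verts Hs h) N. edge_product (X((i,j):=1)) (edges Hs h) q) -
       (\<Sum>q\<in>injmaps (verts Hs h) N. edge_product (X((i,j):=0)) (edges Hs h) q)))"
  proof -
    \<comment> \<open>The case \<open>F = 0\<close> really occurs, for graphs with more than
      \<open>N\<close> vertices.\<close>
    have "(x / F * A - x / F * B) / 2 = x / (2 * F) * (A - B)" for x F A B :: real
      by (cases "F = 0") (simp_all add: field_simps)
    then show ?thesis
      unfolding pdiff_def subgraph_fun_alt
      by (subst sum_subtractf[symmetric], subst sum_divide_distrib, simp only:)
  qed
  also have "\<dots> = (\<Sum>h<length Hs. real N * (real N - 1) * weight Hs h / (2 * falling N (verts Hs h)) *
      (\<Sum>ab\<in>edges Hs h. \<Sum>q\<in>injmaps (verts Hs h) N.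
        if hits q ab (i,j) then edge_product X (edges Hs h - {ab}) q else 0))"
  proof (rule sum.cong[OF refl])
    fix h assume "h \<in> {..<length Hs}"
    then have "h < length Hs" by simp
    from *[OF this]
    show "real N * (real N - 1) * weight Hs h / (2 * falling N (verts Hs h)) *
      ((\<Sum>q\<in>injmaps (verts Hs h) N. edge_product (X((i,j):=1)) (edges Hs h) q) -
       (\<Sum>q\<in>injmaps (verts Hs h) N. edge_product (X((i,j):=0)) (edges Hs h) q)) =
      real N * (real N - 1) * weight Hs h / (2 * falling N (verts Hs h)) *
      (\<Sum>ab\<in>edges Hs h. \<Sum>q\<in>injmaps (verts Hs h) N.
        if hits q ab (i,j) then edge_product X (edges Hs h - {ab}) q else 0)"
      by (rule arg_cong)
  qed
  finally show ?thesis .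
qed

text \<open>The prefactor \<open>N * (N - 1)\<close> cancels the probability that a uniform
  injection takes a prescribed ordered pair as value. What remains is an average over injections
  whose law does not involve \<open>(i, j)\<close>; the two relocated terms are the two
  orientations.\<close>

lemma pdiff_subgraph_fun_relocate:
  assumes H: "\<forall>h\<in>set Hs. simple_graph (fst h)" and ij: "(i,j) \<in> edge_set N"
  shows "pdiff (subgraph_fun N Hs) (i,j) X =
    (\<Sum>h<length Hs. weight Hs h / falling N (verts Hs h) *
      (\<Sum>ab\<in>edges Hs h. \<Sum>q\<in>injmaps (verts Hs h) N.
        (edge_product X (edges Hs h - {ab}) (relocate (q (fst ab)) (q (snd ab)) i j \<circ> q) +
         edge_product X (edges Hs h - {ab}) (relocate (q (fst ab)) (q (snd ab)) j i \<circ> q)) / 2))"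
proof -
  have ltij: "i < j" "(i,j) \<in> offdiag N" "(j,i) \<in> offdiag N"
    using ij by (auto simp: edge_set_def offdiag_def)
  have *: "real N * (real N - 1) * (\<Sum>q\<in>injmaps m N. if hits q ab (i,j) then edge_product X (T - {ab}) q else 0)
     = 2 * (\<Sum>q\<in>injmaps m N. (edge_product X (T - {ab}) (relocate (q (fst ab)) (q (snd ab)) i j \<circ> q) +
         edge_product X (T - {ab}) (relocate (q (fst ab)) (q (snd ab)) j i \<circ> q)) / 2)"
    if T: "T \<subseteq> {(a,b). a < b \<and> b < m}" and ab: "ab \<in> T" for T m ab
  proof -
    have ab': "fst ab < m" "snd ab < m" "fst ab \<noteq> snd ab" using T ab by auto
    have cong: "edge_product X (T - {ab}) q = edge_product X (T - {ab}) q'"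
      if "\<And>l. l < m \<Longrightarrow> q l = q' l" for q q'
      by (rule edge_product_cong[of _ m]) (use T that in auto)
    have "(\<Sum>q\<in>injmaps m N. if hits q ab (i,j) then edge_product X (T - {ab}) q else 0)
       = (\<Sum>q\<in>injmaps m N. (if (q (fst ab), q (snd ab)) = (i,j) then edge_product X (T - {ab}) q else 0) +
           (if (q (fst ab), q (snd ab)) = (j,i) then edge_product X (T - {ab}) q else 0))"
      by (rule sum.cong) (use ltij in \<open>auto simp: hits_def\<close>)
    also have "\<dots> = (\<Sum>q | q \<in> injmaps m N \<and> (q (fst ab), q (snd ab)) = (i,j). edge_product X (T - {ab}) q) +
        (\<Sum>q | q \<in> injmaps m N \<and> (q (fst ab), q (snd ab)) = (j,i). edge_product X (T - {ab}) q)"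
      unfolding sum.distrib by (simp add: sum.inter_filter)
    finally have eq: "(\<Sum>q\<in>injmaps m N. if hits q ab (i,j) then edge_product X (T - {ab}) q else 0) = \<dots>" .
    have r: "(\<Sum>q\<in>injmaps m N. edge_product X (T - {ab}) (relocate (q (fst ab)) (q (snd ab)) k l \<circ> q))
        = real N * (real N - 1) * (\<Sum>q | q \<in> injmaps m N \<and> (q (fst ab), q (snd ab)) = (k, l). edge_product X (T - {ab}) q)"
      if "(k, l) \<in> offdiag N" for k l
      by (rule sum_relocate[OF ab' that]) (rule cong)
    show ?thesis
      unfolding eq distrib_left sum_divide_distrib[symmetric] sum.distrib r[OF ltij(2)] r[OF ltij(3)] by simp
  qed
  show ?thesis
    unfolding pdiff_subgraph_fun[OF H ltij(1)]
  proof (rule sum.cong[OF refl])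
    fix h assume h: "h \<in> {..<length Hs}"
    define m T where "m = verts Hs h" and "T = edges Hs h"
    have T: "T \<subseteq> {(a,b). a < b \<and> b < m}"
      using H h by (auto simp: simple_graph_def T_def m_def)
    have eq: "real N * (real N - 1) * (\<Sum>ab\<in>T. \<Sum>q\<in>injmaps m N. if hits q ab (i,j) then edge_product X (T - {ab}) q else 0)
       = 2 * (\<Sum>ab\<in>T. \<Sum>q\<in>injmaps m N. (edge_product X (T - {ab}) (relocate (q (fst ab)) (q (snd ab)) i j \<circ> q) +
         edge_product X (T - {ab}) (relocate (q (fst ab)) (q (snd ab)) j i \<circ> q)) / 2)" (is "_ * ?L = 2 * ?R")
      unfolding sum_distrib_left[of _ _ T] by (rule sum.cong[OF refl], rule *[OF T])
    have gen: "k * x / (2 * F) * l = x / F * r" if "k * l = 2 * r" for k x F l r :: real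
    proof -
      have "k * x / (2 * F) * l = x / (2 * F) * (k * l)" by simp
      then show ?thesis by (simp add: that)
    qed
    from gen[OF eq] show "real N * (real N - 1) * weight Hs h / (2 * falling N (verts Hs h)) *
         (\<Sum>ab\<in>edges Hs h. \<Sum>q\<in>injmaps (verts Hs h) N.
               if hits q ab (i, j) then edge_product X (edges Hs h - {ab}) q else 0) =
         weight Hs h / falling N (verts Hs h) *
         (\<Sum>ab\<in>edges Hs h. \<Sum>q\<in>injmaps (verts Hs h) N.
               (edge_product X (edges Hs h - {ab}) (relocate (q (fst ab)) (q (snd ab)) i j \<circ> q) +
                edge_product X (edges Hs h - {ab}) (relocate (q (fst ab)) (q (snd ab)) j i \<circ> q)) / 2)"
      unfolding m_def T_def .
  qed
qed

section \<open>Bounds on edge products, and their means under product measures\<close>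

lemma finite_edges:
  assumes "T \<subseteq> {(a,b). a < b \<and> b < (m::nat)}"
  shows "finite T"
  by (rule finite_subset[OF assms]) (rule finite_subset[of _ "{..<m} \<times> {..<m}"], auto)

lemma edges_subset:
  assumes "\<forall>h\<in>set Hs. simple_graph (fst h)" "h < length Hs"
  shows "edges Hs h \<subseteq> {(a,b). a < b \<and> b < verts Hs h}"
  using assms by (auto simp: simple_graph_def)

lemma sum_weight_le:
  "(\<Sum>h<length Hs. \<bar>weight Hs h\<bar> * (real (card (edges Hs h)))\<^sup>2) \<le> C_beta Hs / 12"
  by (simp add: C_beta_def)

lemma C_beta_ge_2: "2 \<le> C_beta Hs"
  by (simp add: C_beta_def)

lemma abs_entry_gvec_le: "\<bar>entry (gvec A) x y\<bar> \<le> 1"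
  by (auto simp: entry_def gvec_def)

lemma abs_edge_product_gvec_le: "\<bar>edge_product (gvec A) T q\<bar> \<le> 1"
  unfolding edge_product_def abs_prod
  by (rule prod_le_1) (auto simp: abs_entry_gvec_le)

lemma entry_as_edge:
  assumes "x \<noteq> y"
  shows "entry X x y = X (min x y, max x y)"
  using assms by (auto simp: entry_def min_def max_def)

text \<open>Injectivity of \<open>q\<close> keeps distinct edges of \<open>T\<close> distinct, so
  the monomial is squarefree. This is what allows independence to be used factor by factor.\<close>

lemma edge_product_as_monomial:
  assumes T: "T \<subseteq> {(a,b). a < b \<and> b < m}" and q: "q \<in> injmaps m N"
  obtains T' where "T' \<subseteq> edge_set N" "\<And>X. edge_product X T q = (\<Prod>e\<in>T'. X e)"
proof -
  define \<psi> where "\<psi> = (\<lambda>cd. (min (q (fst cd)) (q (snd cd)), max (q (fst cd)) (q (snd cd))))"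
  have sub: "\<psi> ` T \<subseteq> edge_set N"
  proof (rule image_subsetI)
    fix cd assume "cd \<in> T"
    then obtain c d where [simp]: "cd = (c, d)" and "c < d" "d < m" using T by auto
    then show "\<psi> cd \<in> edge_set N"
      using injmapsD[OF q] by (auto simp: \<psi>_def edge_set_def min_def max_def neq_iff)
        (metis le_neq_implies_less less_trans nat_neq_iff)+
  qed
  have inj: "inj_on \<psi> T"
  proof (rule inj_onI)
    fix ab cd assume *: "ab \<in> T" "cd \<in> T" "\<psi> ab = \<psi> cd"
    obtain a b c d where [simp]: "ab = (a, b)" "cd = (c, d)" by (metis surj_pair)
    have "a < b" "b < m" "c < d" "d < m" using * T by auto
    then have "(q c = q a) = (c = a)" "(q d = q b) = (d = b)" "(q c = q b) = (c = b)" "(q d = q a) = (d = a)"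
      using injmapsD(2)[OF q] by auto
    moreover have "q c = q a \<and> q d = q b \<or> q c = q b \<and> q d = q a"
      using *(3) by (auto simp: \<psi>_def min_def max_def split: if_splits)
    ultimately show "ab = cd" using \<open>a < b\<close> \<open>c < d\<close> by auto
  qed
  have "edge_product X T q = (\<Prod>e\<in>\<psi> ` T. X e)" for X
    unfolding edge_product_def prod.reindex[OF inj]
  proof (rule prod.cong[OF refl])
    fix cd assume "cd \<in> T"
    then obtain c d where [simp]: "cd = (c, d)" and "c < d" "d < m" using T by auto
    then have "q c \<noteq> q d" using injmapsD[OF q] by auto
    then show "(case cd of (l, l') \<Rightarrow> entry X (q l) (q l')) = (X \<circ> \<psi>) cd"
      by (simp add: entry_as_edge \<psi>_def)
  qed
  with sub show ?thesis by (rule that)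
qed

text \<open>The mean of a product of independent Bernoulli indicators, proved algebraically for
  arbitrary real \<open>p\<close>. The sum over subsets is the expansion of a product of two-term
  sums, each equal to \<open>p e\<close> on \<open>T\<close> and to 1 elsewhere.\<close>

lemma sum_Pow_monomial:
  fixes p :: "nat \<times> nat \<Rightarrow> real"
  assumes fin: "finite E" and T: "T \<subseteq> E"
  shows "(\<Sum>A\<in>Pow E. (\<Prod>e\<in>E. if e \<in> A then p e else 1 - p e) * (\<Prod>e\<in>T. gvec A e)) = (\<Prod>e\<in>T. p e)"
proof -
  have "(\<Sum>A\<in>Pow E. (\<Prod>e\<in>E. if e \<in> A then p e else 1 - p e) * (\<Prod>e\<in>T. gvec A e))
      = (\<Sum>A\<in>Pow E. (\<Prod>e\<in>A. p e) * (\<Prod>e\<in>E - A. if e \<in> T then 0 else 1 - p e))"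
  proof (rule sum.cong[OF refl])
    fix A assume A: "A \<in> Pow E"
    have "(\<Prod>e\<in>T. gvec A e) = (\<Prod>e\<in>E. if e \<in> T then gvec A e else 1)"
      by (rule prod.mono_neutral_cong_left) (use fin T in auto)
    then have "(\<Prod>e\<in>E. if e \<in> A then p e else 1 - p e) * (\<Prod>e\<in>T. gvec A e)
       = (\<Prod>e\<in>E. if e \<in> A then p e else if e \<in> T then 0 else 1 - p e)"
      unfolding prod.distrib[symmetric] by (auto intro!: prod.cong simp: gvec_def prod.distrib[symmetric])
    also have "\<dots> = (\<Prod>e\<in>A. p e) * (\<Prod>e\<in>E - A. if e \<in> T then 0 else 1 - p e)"
      using A fin by (subst prod.If_cases) (auto simp: Int_absorb1 Diff_eq)
    finally show "(\<Prod>e\<in>E. if e \<in> A then p e else 1 - p e) * (\<Prod>e\<in>T. gvec A e)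
       = (\<Prod>e\<in>A. p e) * (\<Prod>e\<in>E - A. if e \<in> T then 0 else 1 - p e)" .
  qed
  also have "\<dots> = (\<Prod>e\<in>E. p e + (if e \<in> T then 0 else 1 - p e))"
    by (rule prod_add[OF fin, symmetric])
  also have "\<dots> = (\<Prod>e\<in>T. p e)"
    by (rule prod.mono_neutral_cong_right) (use fin T in auto)
  finally show ?thesis .
qed

lemma sum_indep_prob: "(\<Sum>A\<in>Pow (edge_set N). indep_prob N p A) = 1"
  using sum_Pow_monomial[of "edge_set N" "{}" p] by (simp add: indep_prob_def Pow_def)

lemma mean_edge_product:
  assumes "T \<subseteq> {(a,b). a < b \<and> b < m}" "q \<in> injmaps m N"
  shows "(\<Sum>A\<in>Pow (edge_set N). indep_prob N p A * edge_product (gvec A) T q) = edge_product p T q"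
proof -
  obtain T' where "T' \<subseteq> edge_set N" "\<And>X. edge_product X T q = (\<Prod>e\<in>T'. X e)"
    using edge_product_as_monomial[OF assms] by blast
  then show ?thesis
    using sum_Pow_monomial[of "edge_set N" T' p] by (simp add: indep_prob_def Pow_def)
qed

text \<open>By linearity this reduces to squarefree monomials. It replaces the derivative at the
  deterministic point \<open>p\<close> by an average over graphs, which a coupling can compare with
  the Gibbs sample.\<close>

lemma mean_pdiff:
  assumes H: "\<forall>h\<in>set Hs. simple_graph (fst h)" and e: "e \<in> edge_set N"
  shows "(\<Sum>A\<in>Pow (edge_set N). indep_prob N p A * pdiff (subgraph_fun N Hs) e (gvec A))
    = pdiff (subgraph_fun N Hs) e p"
proof -
  obtain i j where e': "e = (i, j)" and ij: "i < j" using e by (auto simp: edge_set_def)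
  let ?P = "Pow (edge_set N)"
  let ?c = "\<lambda>h. real N * (real N - 1) * weight Hs h / (2 * falling N (verts Hs h))"
  let ?F = "\<lambda>X h ab q. if hits q ab (i,j) then edge_product X (edges Hs h - {ab}) q else 0"
  have "(\<Sum>A\<in>?P. indep_prob N p A * pdiff (subgraph_fun N Hs) e (gvec A))
     = (\<Sum>A\<in>?P. \<Sum>h<length Hs. \<Sum>ab\<in>edges Hs h. \<Sum>q\<in>injmaps (verts Hs h) N.
          ?c h * (indep_prob N p A * ?F (gvec A) h ab q))"
    unfolding e' pdiff_subgraph_fun[OF H ij] sum_distrib_left
    by (intro sum.cong refl) (simp add: mult_ac)
  also have "\<dots> = (\<Sum>h<length Hs. \<Sum>ab\<in>edges Hs h. \<Sum>q\<in>injmaps (verts Hs h) N. \<Sum>A\<in>?P.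
          ?c h * (indep_prob N p A * ?F (gvec A) h ab q))"
    by (simp only: sum.swap[of _ _ ?P])
  also have "\<dots> = (\<Sum>h<length Hs. \<Sum>ab\<in>edges Hs h. \<Sum>q\<in>injmaps (verts Hs h) N. ?c h * ?F p h ab q)"
  proof (intro sum.cong refl)
    fix h ab q assume "h \<in> {..<length Hs}" "ab \<in> edges Hs h" and q: "q \<in> injmaps (verts Hs h) N"
    then have T: "edges Hs h - {ab} \<subseteq> {(a,b). a < b \<and> b < verts Hs h}"
      using edges_subset[OF H, of h] by auto
    show "(\<Sum>A\<in>?P. ?c h * (indep_prob N p A * ?F (gvec A) h ab q)) = ?c h * ?F p h ab q"
      unfolding sum_distrib_left[symmetric] using mean_edge_product[OF T q] by auto
  qed
  also have "\<dots> = pdiff (subgraph_fun N Hs) e p"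
    unfolding e' pdiff_subgraph_fun[OF H ij] sum_distrib_left ..
  finally show ?thesis .
qed

section \<open>Lipschitz dependence of the gradient on the Hamming distance\<close>

lemma edge_product_lipschitz:
  "\<bar>edge_product (gvec A) T q - edge_product (gvec B) T q\<bar>
     \<le> (\<Sum>cd\<in>T. \<bar>entry (gvec A) (q (fst cd)) (q (snd cd)) - entry (gvec B) (q (fst cd)) (q (snd cd))\<bar>)"
  using norm_prod_diff[of T "\<lambda>cd. entry (gvec A) (q (fst cd)) (q (snd cd))"
      "\<lambda>cd. entry (gvec B) (q (fst cd)) (q (snd cd))"]
  by (simp add: edge_product_def case_prod_beta abs_entry_gvec_le)

lemma sum_entry_diff:
  assumes "A \<subseteq> edge_set N" "B \<subseteq> edge_set N"
  shows "(\<Sum>(x,y)\<in>offdiag N. \<bar>entry (gvec A) x y - entry (gvec B) x y\<bar>) = 2 * real (card (A - B \<union> (B - A)))"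
proof -
  have "(\<Sum>(x,y)\<in>offdiag N. \<bar>entry (gvec A) x y - entry (gvec B) x y\<bar>)
     = 2 * (\<Sum>(x,y)\<in>edge_set N. \<bar>entry (gvec A) x y - entry (gvec B) x y\<bar>)"
    by (rule sum_offdiag_symmetric) (auto simp: entry_def)
  also have "(\<Sum>(x,y)\<in>edge_set N. \<bar>entry (gvec A) x y - entry (gvec B) x y\<bar>)
     = (\<Sum>e\<in>edge_set N. if e \<in> A - B \<union> (B - A) then 1 else 0)"
    by (rule sum.cong) (auto simp: edge_set_def entry_def gvec_def)
  also have "\<dots> = real (card (edge_set N \<inter> (A - B \<union> (B - A))))"
    by (simp add: sum.If_cases Int_def)
  also have "edge_set N \<inter> (A - B \<union> (B - A)) = A - B \<union> (B - A)" using assms by auto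
  finally show ?thesis .
qed

text \<open>For a fixed injection and distinguished edge \<open>ab\<close> only one \<open>e\<close>
  matters, so the sum over \<open>e\<close> disappears. Every other edge \<open>cd\<close> has a
  uniform image and meets a differing edge with probability proportional to the Hamming distance.
  Summing over \<open>ab\<close> and \<open>cd\<close> produces the squared edge counts in
  \<open>C_beta\<close>.\<close>

lemma pdiff_lipschitz:
  assumes H: "\<forall>h\<in>set Hs. simple_graph (fst h)" and A: "A \<subseteq> edge_set N" and B: "B \<subseteq> edge_set N" and N: "N \<ge> 2"
  shows "(\<Sum>e\<in>edge_set N. \<bar>pdiff (subgraph_fun N Hs) e (gvec A) - pdiff (subgraph_fun N Hs) e (gvec B)\<bar>)
    \<le> C_beta Hs / 12 * real (card (A - B \<union> (B - A)))"
proof -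
  define G where "G = (\<lambda>(x,y). \<bar>entry (gvec A) x y - entry (gvec B) x y\<bar>)"
  define \<delta> where "\<delta> = real (card (A - B \<union> (B - A)))"
  define c where "c = (\<lambda>h. real N * (real N - 1) * weight Hs h / (2 * falling N (verts Hs h)))"
  have c_apply: "real N * (real N - 1) * weight Hs h / (2 * falling N (verts Hs h)) = c h" for h
    by (simp add: c_def)
  define \<Delta> where "\<Delta> = (\<lambda>h ab q. \<bar>edge_product (gvec A) (edges Hs h - {ab}) q - edge_product (gvec B) (edges Hs h - {ab}) q\<bar>)"
  have NN: "real N * (real N - 1) > 0" using N by simp
  have pt: "\<bar>pdiff (subgraph_fun N Hs) e (gvec A) - pdiff (subgraph_fun N Hs) e (gvec B)\<bar>
     \<le> (\<Sum>h<length Hs. \<Sum>ab\<in>edges Hs h. \<Sum>q\<in>injmaps (verts Hs h) N. \<bar>c h\<bar> * (if hits q ab e then \<Delta> h ab q else 0))"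
    if e: "e \<in> edge_set N" for e
  proof -
    obtain i j where e': "e = (i, j)" and ij: "i < j" using e by (auto simp: edge_set_def)
    have "pdiff (subgraph_fun N Hs) e (gvec A) - pdiff (subgraph_fun N Hs) e (gvec B)
      = (\<Sum>h<length Hs. \<Sum>ab\<in>edges Hs h. \<Sum>q\<in>injmaps (verts Hs h) N. c h * (if hits q ab e
          then edge_product (gvec A) (edges Hs h - {ab}) q - edge_product (gvec B) (edges Hs h - {ab}) q else 0))"
      unfolding e' pdiff_subgraph_fun[OF H ij] c_apply sum_distrib_left sum_subtractf[symmetric]
      by (intro sum.cong refl) (simp add: right_diff_distrib)
    also have "\<bar>\<dots>\<bar> \<le> (\<Sum>h<length Hs. \<Sum>ab\<in>edges Hs h. \<Sum>q\<in>injmaps (verts Hs h) N. \<bar>c h\<bar> * (if hits q ab e then \<Delta> h ab q else 0))"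
      by (intro order_trans[OF sum_abs] sum_mono) (simp add: abs_mult \<Delta>_def)
    finally show ?thesis .
  qed
  \<comment> \<open>Only the edge joining the images of the endpoints of \<open>ab\<close> can be
    hit.\<close>
  have one: "(\<Sum>e\<in>edge_set N. if hits q ab e then t else 0) \<le> t" if "t \<ge> 0" for q ab and t :: real
  proof -
    have "{e \<in> edge_set N. hits q ab e} \<subseteq> {(min (q (fst ab)) (q (snd ab)), max (q (fst ab)) (q (snd ab)))}"
      by (auto simp: hits_def edge_set_def)
    then have "card {e \<in> edge_set N. hits q ab e} \<le> 1"
      by (metis card.empty card_insert_disjoint card_mono empty_iff finite.emptyI finite.insertI One_nat_def)
    then have "real (card {e \<in> edge_set N. hits q ab e}) * t \<le> 1 * t"
      by (intro mult_right_mono that) simp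
    then show ?thesis by (simp add: sum.inter_filter[symmetric])
  qed
  \<comment> \<open>The ordered pairs count each differing edge twice, hence
    \<open>2 * \<delta>\<close>; this 2 cancels the one in the denominator of
    \<open>c\<close>.\<close>
  have pair: "real N * (real N - 1) * (\<Sum>q\<in>injmaps (verts Hs h) N. \<Delta> h ab q) \<le>
      falling N (verts Hs h) * (real (card (edges Hs h)) * (2 * \<delta>))"
    if h: "h < length Hs" and ab: "ab \<in> edges Hs h" for h ab
  proof -
    note T = edges_subset[OF H h]
    have "(\<Sum>q\<in>injmaps (verts Hs h) N. \<Delta> h ab q)
        \<le> (\<Sum>q\<in>injmaps (verts Hs h) N. \<Sum>cd\<in>edges Hs h. G (q (fst cd), q (snd cd)))"
    proof (rule sum_mono)
      fix q
      have "\<Delta> h ab q \<le> (\<Sum>cd\<in>edges Hs h - {ab}. G (q (fst cd), q (snd cd)))"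
        unfolding \<Delta>_def G_def using edge_product_lipschitz by simp
      also have "\<dots> \<le> (\<Sum>cd\<in>edges Hs h. G (q (fst cd), q (snd cd)))"
        by (rule sum_mono2) (auto simp: finite_edges[OF T] G_def)
      finally show "\<Delta> h ab q \<le> (\<Sum>cd\<in>edges Hs h. G (q (fst cd), q (snd cd)))" .
    qed
    also have "\<dots> = (\<Sum>cd\<in>edges Hs h. \<Sum>q\<in>injmaps (verts Hs h) N. G (q (fst cd), q (snd cd)))"
      by (rule sum.swap)
    finally have "real N * (real N - 1) * (\<Sum>q\<in>injmaps (verts Hs h) N. \<Delta> h ab q) \<le> 
       real N * (real N - 1) * (\<Sum>cd\<in>edges Hs h. \<Sum>q\<in>injmaps (verts Hs h) N. G (q (fst cd), q (snd cd)))"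
      using NN by (intro mult_left_mono) auto
    also have "\<dots> = (\<Sum>cd\<in>edges Hs h. real N * (real N - 1) * (\<Sum>q\<in>injmaps (verts Hs h) N. G (q (fst cd), q (snd cd))))"
      by (rule sum_distrib_left)
    also have "\<dots> = (\<Sum>cd\<in>edges Hs h. falling N (verts Hs h) * (2 * \<delta>))"
    proof (rule sum.cong[OF refl])
      fix cd assume "cd \<in> edges Hs h"
      then have "fst cd < verts Hs h" "snd cd < verts Hs h" "fst cd \<noteq> snd cd" using T by auto
      from sum_injmaps_pair[OF this, of N G]
      show "real N * (real N - 1) * (\<Sum>q\<in>injmaps (verts Hs h) N. G (q (fst cd), q (snd cd))) = falling N (verts Hs h) * (2 * \<delta>)"
        using sum_entry_diff[OF A B] by (simp add: G_def \<delta>_def)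
    qed
    finally show ?thesis by (simp add: mult_ac)
  qed
  have "(\<Sum>e\<in>edge_set N. \<bar>pdiff (subgraph_fun N Hs) e (gvec A) - pdiff (subgraph_fun N Hs) e (gvec B)\<bar>)
    \<le> (\<Sum>e\<in>edge_set N. \<Sum>h<length Hs. \<Sum>ab\<in>edges Hs h. \<Sum>q\<in>injmaps (verts Hs h) N. \<bar>c h\<bar> * (if hits q ab e then \<Delta> h ab q else 0))"
    by (intro sum_mono pt)
  also have "\<dots> = (\<Sum>h<length Hs. \<Sum>ab\<in>edges Hs h. \<Sum>q\<in>injmaps (verts Hs h) N. \<Sum>e\<in>edge_set N. \<bar>c h\<bar> * (if hits q ab e then \<Delta> h ab q else 0))"
    by (simp only: sum.swap[of _ _ "edge_set N"])
  also have "\<dots> \<le> (\<Sum>h<length Hs. \<Sum>ab\<in>edges Hs h. \<Sum>q\<in>injmaps (verts Hs h) N. \<bar>c h\<bar> * \<Delta> h ab q)"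
    unfolding sum_distrib_left[symmetric]
    by (intro sum_mono mult_left_mono sum_mono one) (auto simp: \<Delta>_def)
  also have "\<dots> \<le> (\<Sum>h<length Hs. \<bar>weight Hs h\<bar> * (real (card (edges Hs h)))\<^sup>2 * \<delta>)"
  proof (rule sum_mono)
    fix h assume "h \<in> {..<length Hs}"
    then have h: "h < length Hs" by simp
    have "\<bar>c h\<bar> = \<bar>weight Hs h\<bar> / (2 * falling N (verts Hs h)) * (real N * (real N - 1))"
      using N falling_nonneg[of N "verts Hs h"] by (simp add: c_def abs_mult)
    then have "(\<Sum>ab\<in>edges Hs h. \<Sum>q\<in>injmaps (verts Hs h) N. \<bar>c h\<bar> * \<Delta> h ab q)
       = (\<Sum>ab\<in>edges Hs h. \<bar>weight Hs h\<bar> / (2 * falling N (verts Hs h)) *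
           (real N * (real N - 1) * (\<Sum>q\<in>injmaps (verts Hs h) N. \<Delta> h ab q)))"
      by (simp add: sum_distrib_left mult_ac)
    also have "\<dots> \<le> (\<Sum>ab\<in>edges Hs h. \<bar>weight Hs h\<bar> / (2 * falling N (verts Hs h)) *
           (falling N (verts Hs h) * (real (card (edges Hs h)) * (2 * \<delta>))))"
      by (intro sum_mono mult_left_mono pair h) (auto simp: falling_nonneg)
    also have "\<dots> = \<bar>weight Hs h\<bar> / (2 * falling N (verts Hs h)) *
           falling N (verts Hs h) * 2 * ((real (card (edges Hs h)))\<^sup>2 * \<delta>)"
      by (simp add: power2_eq_square)
    also have "\<dots> \<le> \<bar>weight Hs h\<bar> * ((real (card (edges Hs h)))\<^sup>2 * \<delta>)"
      by (intro mult_right_mono) (auto simp: \<delta>_def)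
    finally show "(\<Sum>ab\<in>edges Hs h. \<Sum>q\<in>injmaps (verts Hs h) N. \<bar>c h\<bar> * \<Delta> h ab q)
        \<le> \<bar>weight Hs h\<bar> * (real (card (edges Hs h)))\<^sup>2 * \<delta>" by simp
  qed
  also have "\<dots> \<le> C_beta Hs / 12 * \<delta>"
    unfolding sum_distrib_right[symmetric]
    by (intro mult_right_mono sum_weight_le) (simp add: \<delta>_def)
  finally show ?thesis unfolding \<delta>_def .
qed

section \<open>Sampling the gradient\<close>

lemma tanh_lipschitz: "\<bar>tanh x - tanh y\<bar> \<le> \<bar>x - y\<bar>" for x y :: real
proof -
  have *: "tanh b - tanh a \<le> b - a" if "a < b" for a b :: real
  proof -
    have "\<exists>z>a. z < b \<and> tanh b - tanh a = (b - a) * (1 - (tanh z)\<^sup>2)"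
      by (rule MVT2[OF that]) (auto intro!: derivative_eq_intros)
    then obtain z where "tanh b - tanh a = (b - a) * (1 - (tanh z)\<^sup>2)" by blast
    also have "\<dots> \<le> (b - a) * 1" using that by (intro mult_left_mono) auto
    finally show ?thesis by simp
  qed
  show ?thesis
    using *[of x y] *[of y x] tanh_real_le_iff[of x y] tanh_real_le_iff[of y x]
    by (cases x y rule: linorder_cases) auto
qed

lemma entry_gvec_Int:
  assumes "x < N" "y < N" "x \<in> W \<or> y \<in> W"
    and S: "S = {(i,j) \<in> edge_set N. i \<in> W \<or> j \<in> W}"
  shows "entry (gvec (A \<inter> S)) x y = entry (gvec A) x y"
  using assms by (auto simp: entry_def gvec_def edge_set_def)

lemma card_incident_edges:
  assumes "finite W" "S = {(i,j) \<in> edge_set N. i \<in> W \<or> j \<in> W}"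
  shows "card S \<le> card W * N"
proof -
  have "S \<subseteq> (\<lambda>(w,k). (min w k, max w k)) ` (W \<times> {..<N})"
  proof
    fix e assume "e \<in> S"
    then obtain i j where e: "e = (i, j)" "i < j" "j < N" "i \<in> W \<or> j \<in> W"
      using assms(2) by (auto simp: edge_set_def)
    from this(4) show "e \<in> (\<lambda>(w,k). (min w k, max w k)) ` (W \<times> {..<N})"
    proof
      assume "i \<in> W"
      with e show ?thesis by (intro rev_image_eqI[of "(i, j)"]) auto
    next
      assume "j \<in> W"
      with e show ?thesis by (intro rev_image_eqI[of "(j, i)"]) auto
    qed
  qed
  then have "card S \<le> card ((\<lambda>(w,k). (min w k, max w k)) ` (W \<times> {..<N}))"
    using assms(1) by (intro card_mono) auto
  also have "\<dots> \<le> card (W \<times> {..<N})"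
    using assms(1) by (intro card_image_le) auto
  finally show ?thesis by (simp add: card_cartesian_product)
qed

lemma card_UN_list_le: "card (\<Union>z\<in>set zs. V z) \<le> (\<Sum>z\<leftarrow>zs. card (V z))"
proof (induction zs)
  case (Cons z zs)
  then show ?case
    using card_Un_le[of "V z" "\<Union>z\<in>set zs. V z"] by simp
qed simp

section \<open>Random placements with a distinguished edge, used as samples\<close>

type_synonym sample = "nat \<times> (nat \<times> nat) \<times> (nat \<Rightarrow> nat)"

text \<open>A sample fixes a graph, its distinguished edge and an injection, but not the edge
  \<open>e\<close> on which the distinguished edge is put. The same sample can therefore be
  evaluated at every \<open>e\<close>.\<close>

definition samples :: "((nat \<times> (nat \<times> nat) set) \<times> real) list \<Rightarrow> nat \<Rightarrow> sample set" where
  "samples Hs N = (SIGMA h:{..<length Hs}. edges Hs h \<times> injmaps (verts Hs h) N)"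

definition sample_value ::
  "((nat \<times> (nat \<times> nat) set) \<times> real) list \<Rightarrow> sample \<Rightarrow> nat \<times> nat \<Rightarrow> (nat \<times> nat \<Rightarrow> real) \<Rightarrow> real" where
  "sample_value Hs = (\<lambda>(h, ab, q) (i, j) X. C_beta Hs * sgn (weight Hs h) *
     ((edge_product X (edges Hs h - {ab}) (relocate (q (fst ab)) (q (snd ab)) i j \<circ> q) +
       edge_product X (edges Hs h - {ab}) (relocate (q (fst ab)) (q (snd ab)) j i \<circ> q)) / 2))"

text \<open>The normalisation makes all values bounded by \<open>C_beta\<close> while the weights sum to at most 1. Graphs
  with more than \<open>N\<close> vertices have \<open>falling = 0\<close>, but they contribute no samples.\<close>

definition sample_weight :: "((nat \<times> (nat \<times> nat) set) \<times> real) list \<Rightarrow> nat \<Rightarrow> sample \<Rightarrow> real" where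
  "sample_weight Hs N = (\<lambda>(h, ab, q). \<bar>weight Hs h\<bar> / (falling N (verts Hs h) * C_beta Hs))"

text \<open>Only images of endpoints of edges are recorded. Isolated vertices are left out, so the
  size is controlled by the number of edges.\<close>

definition sample_vertices :: "((nat \<times> (nat \<times> nat) set) \<times> real) list \<Rightarrow> sample \<Rightarrow> nat set" where
  "sample_vertices Hs = (\<lambda>(h, ab, q). q ` (fst ` edges Hs h \<union> snd ` edges Hs h))"

lemma sum_samples:
  assumes H: "\<forall>h\<in>set Hs. simple_graph (fst h)"
  shows "sum F (samples Hs N) = (\<Sum>h<length Hs. \<Sum>ab\<in>edges Hs h. \<Sum>q\<in>injmaps (verts Hs h) N. F (h, ab, q))"
proof -
  have fin: "\<forall>h\<in>{..<length Hs}. finite (edges Hs h \<times> injmaps (verts Hs h) N)"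
    using finite_edges[OF edges_subset[OF H]] by auto
  have "sum F (samples Hs N) = (\<Sum>h<length Hs. \<Sum>x\<in>edges Hs h \<times> injmaps (verts Hs h) N. F (h, x))"
    unfolding samples_def by (subst sum.Sigma[OF _ fin]) (auto simp: case_prod_eta)
  also have "\<dots> = (\<Sum>h<length Hs. \<Sum>ab\<in>edges Hs h. \<Sum>q\<in>injmaps (verts Hs h) N. F (h, ab, q))"
    by (simp add: sum.cartesian_product case_prod_eta)
  finally show ?thesis .
qed

lemma finite_samples:
  assumes H: "\<forall>h\<in>set Hs. simple_graph (fst h)"
  shows "finite (samples Hs N)"
  unfolding samples_def using finite_edges[OF edges_subset[OF H]] by auto

lemma pdiff_as_average:
  assumes H: "\<forall>h\<in>set Hs. simple_graph (fst h)" and e: "e \<in> edge_set N"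
  shows "pdiff (subgraph_fun N Hs) e X = (\<Sum>z\<in>samples Hs N. sample_weight Hs N z * sample_value Hs z e X)"
proof -
  obtain i j where e': "e = (i, j)" by (cases e)
  have C: "C_beta Hs \<noteq> 0" using C_beta_ge_2[of Hs] by auto
  \<comment> \<open>The signed coefficient is split into its absolute value, which becomes a weight,
    and its sign, which goes into the value.\<close>
  have *: "w / F * t = \<bar>w\<bar> / (F * C_beta Hs) * (C_beta Hs * sgn w * t)" for w F t
    using C by (cases "F = 0") (simp_all add: abs_sgn_eq sgn_if)
  show ?thesis
    unfolding sum_samples[OF H] e' pdiff_subgraph_fun_relocate[OF H e[unfolded e']]
      sample_weight_def sample_value_def prod.case sum_distrib_left
    by (intro sum.cong refl) (rule *)
qed

text \<open>The number of injections cancels \<open>falling\<close>. Only an inequality is claimed,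
  since a graph with more than \<open>N\<close> vertices contributes nothing on the left.\<close>

lemma sum_sample_weight:
  assumes H: "\<forall>h\<in>set Hs. simple_graph (fst h)" and G: "\<And>h. h < length Hs \<Longrightarrow> 0 \<le> G h"
  shows "(\<Sum>z\<in>samples Hs N. sample_weight Hs N z * G (fst z))
    \<le> (\<Sum>h<length Hs. \<bar>weight Hs h\<bar> * real (card (edges Hs h)) * G h) / C_beta Hs"
  unfolding sum_samples[OF H] sample_weight_def sum_divide_distrib
proof (rule sum_mono)
  fix h assume "h \<in> {..<length Hs}"
  then have G: "0 \<le> G h" using G by simp
  have "(\<Sum>ab\<in>edges Hs h. \<Sum>q\<in>injmaps (verts Hs h) N.
          (case (h, ab, q) of (h, ab, q) \<Rightarrow> \<bar>weight Hs h\<bar> / (falling N (verts Hs h) * C_beta Hs)) * G (fst (h, ab, q)))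
     = real (card (edges Hs h)) * (falling N (verts Hs h) * (\<bar>weight Hs h\<bar> / (falling N (verts Hs h) * C_beta Hs) * G h))"
    by (simp add: card_injmaps)
  also have "\<dots> \<le> \<bar>weight Hs h\<bar> * real (card (edges Hs h)) * G h / C_beta Hs"
    using G C_beta_ge_2[of Hs] by (cases "falling N (verts Hs h) = 0") (auto simp: mult_ac)
  finally show "(\<Sum>ab\<in>edges Hs h. \<Sum>q\<in>injmaps (verts Hs h) N.
          (case (h, ab, q) of (h, ab, q) \<Rightarrow> \<bar>weight Hs h\<bar> / (falling N (verts Hs h) * C_beta Hs)) * G (fst (h, ab, q)))
     \<le> \<bar>weight Hs h\<bar> * real (card (edges Hs h)) * G h / C_beta Hs" .
qed

lemma sum_sample_weight_le_1:
  assumes H: "\<forall>h\<in>set Hs. simple_graph (fst h)"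
  shows "(\<Sum>z\<in>samples Hs N. sample_weight Hs N z) \<le> 1"
proof -
  have "(\<Sum>z\<in>samples Hs N. sample_weight Hs N z) \<le> (\<Sum>h<length Hs. \<bar>weight Hs h\<bar> * real (card (edges Hs h))) / C_beta Hs"
    using sum_sample_weight[OF H, of "\<lambda>_. 1" N] by simp
  also have "\<dots> \<le> (C_beta Hs / 12) / C_beta Hs"
  proof (intro divide_right_mono order_trans[OF _ sum_weight_le] sum_mono mult_left_mono)
    fix h
    have "card (edges Hs h) \<le> (card (edges Hs h))\<^sup>2" by (simp add: power2_eq_square)
    then show "real (card (edges Hs h)) \<le> (real (card (edges Hs h)))\<^sup>2"
      by (metis of_nat_le_iff of_nat_power)
  qed (use C_beta_ge_2[of Hs] in auto)
  also have "\<dots> \<le> 1" using C_beta_ge_2[of Hs] by simp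
  finally show ?thesis .
qed

text \<open>A sample sees at most two vertices per edge of its graph, while the total weight of a
  graph carries one more factor of its edge count. The resulting squares are absorbed by
  \<open>C_beta\<close>.\<close>

lemma sum_sample_vertices:
  assumes H: "\<forall>h\<in>set Hs. simple_graph (fst h)"
  shows "(\<Sum>z\<in>samples Hs N. sample_weight Hs N z * real (card (sample_vertices Hs z))) \<le> 1"
proof -
  have "(\<Sum>z\<in>samples Hs N. sample_weight Hs N z * real (card (sample_vertices Hs z)))
      \<le> (\<Sum>z\<in>samples Hs N. sample_weight Hs N z * (\<lambda>h. 2 * real (card (edges Hs h))) (fst z))"
  proof (intro sum_mono mult_left_mono)
    fix z assume "z \<in> samples Hs N"
    then obtain h ab q where z: "z = (h, ab, q)" and h: "h < length Hs"
      by (auto simp: samples_def)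
    note fin = finite_edges[OF edges_subset[OF H h]]
    have "card (sample_vertices Hs z) \<le> card (fst ` edges Hs h \<union> snd ` edges Hs h)"
      unfolding z sample_vertices_def prod.case using fin by (intro card_image_le) auto
    also have "\<dots> \<le> card (edges Hs h) + card (edges Hs h)"
      by (intro order_trans[OF card_Un_le] add_mono card_image_le fin)
    finally show "real (card (sample_vertices Hs z)) \<le> (\<lambda>h. 2 * real (card (edges Hs h))) (fst z)"
      by (simp add: z)
    show "0 \<le> sample_weight Hs N z"
      using falling_nonneg[of N "verts Hs h"] C_beta_ge_2[of Hs] by (simp add: z sample_weight_def)
  qed
  also have "\<dots> \<le> (\<Sum>h<length Hs. \<bar>weight Hs h\<bar> * real (card (edges Hs h)) * (2 * real (card (edges Hs h)))) / C_beta Hs"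
    by (rule sum_sample_weight[OF H]) simp
  also have "\<dots> = 2 * (\<Sum>h<length Hs. \<bar>weight Hs h\<bar> * (real (card (edges Hs h)))\<^sup>2) / C_beta Hs"
    unfolding sum_distrib_left by (intro arg_cong2[where f="(/)"] sum.cong refl) (simp add: power2_eq_square)
  also have "\<dots> \<le> 2 * (C_beta Hs / 12) / C_beta Hs"
    by (intro divide_right_mono mult_left_mono sum_weight_le) (use C_beta_ge_2[of Hs] in auto)
  also have "\<dots> \<le> 1" using C_beta_ge_2[of Hs] by simp
  finally show ?thesis .
qed

lemma abs_sample_value_le: "\<bar>sample_value Hs z e (gvec A)\<bar> \<le> C_beta Hs"
proof -
  obtain h ab q i j where z: "z = (h, ab, q)" "e = (i, j)" by (metis surj_pair)
  let ?a = "edge_product (gvec A) (edges Hs h - {ab}) (relocate (q (fst ab)) (q (snd ab)) i j \<circ> q)"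
  let ?b = "edge_product (gvec A) (edges Hs h - {ab}) (relocate (q (fst ab)) (q (snd ab)) j i \<circ> q)"
  have "\<bar>?a\<bar> \<le> 1" "\<bar>?b\<bar> \<le> 1" by (rule abs_edge_product_gvec_le)+
  then have "\<bar>(?a + ?b) / 2\<bar> \<le> 1" by (simp add: abs_le_iff)
  then have "\<bar>sgn (weight Hs h)\<bar> * \<bar>(?a + ?b) / 2\<bar> \<le> 1 * 1"
    by (intro mult_mono) (auto simp: sgn_if)
  then have "C_beta Hs * (\<bar>sgn (weight Hs h)\<bar> * \<bar>(?a + ?b) / 2\<bar>) \<le> C_beta Hs * 1"
    using C_beta_ge_2[of Hs] by (intro mult_left_mono) auto
  then show ?thesis
    using C_beta_ge_2[of Hs] by (simp add: z sample_value_def abs_mult mult.assoc)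
qed

text \<open>\<^const>\<open>relocate\<close> sends every vertex except the images of the endpoints of the distinguished edge
  back into the original image, so the sample reveals only edges touching that image, whichever
  edge \<open>e\<close> it is evaluated at.\<close>

lemma sample_value_local:
  assumes H: "\<forall>h\<in>set Hs. simple_graph (fst h)" and z: "z \<in> samples Hs N" and e: "e \<in> edge_set N"
    and W: "sample_vertices Hs z \<subseteq> W"
    and S: "S = {(i,j) \<in> edge_set N. i \<in> W \<or> j \<in> W}"
  shows "sample_value Hs z e (gvec (A \<inter> S)) = sample_value Hs z e (gvec A)"
proof -
  obtain h ab q where z': "z = (h, ab, q)" by (metis surj_pair)
  obtain i j where e': "e = (i, j)" by (cases e)
  have ij: "i \<noteq> j" "i < N" "j < N" using e by (auto simp: e' edge_set_def)
  have h: "h < length Hs" and ab: "ab \<in> edges Hs h" and q: "q \<in> injmaps (verts Hs h) N"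
    using z by (auto simp: z' samples_def)
  note T = edges_subset[OF H h]
  obtain a b where ab': "ab = (a, b)" by (cases ab)
  have abm: "a < b" "b < verts Hs h" using T ab ab' by auto
  then have qab: "q a \<noteq> q b" "q a < N" "q b < N" using injmapsD[OF q] by auto
  have VW: "q l \<in> W" if "l \<in> fst ` edges Hs h \<union> snd ` edges Hs h" for l
    using W that by (auto simp: z' sample_vertices_def)
  have abW: "q a \<in> W" "q b \<in> W" using VW[of a] VW[of b] ab ab' by force+
  have *: "edge_product (gvec (A \<inter> S)) (edges Hs h - {ab}) (relocate (q a) (q b) k l \<circ> q)
      = edge_product (gvec A) (edges Hs h - {ab}) (relocate (q a) (q b) k l \<circ> q)"
    if kl: "k \<noteq> l" "k < N" "l < N" for k l
    unfolding edge_product_def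
  proof (rule prod.cong[OF refl])
    fix cd assume "cd \<in> edges Hs h - {ab}"
    then obtain c d where cd: "cd = (c, d)" "(c, d) \<in> edges Hs h" "(c, d) \<noteq> (a, b)"
      using ab' by (metis DiffE insertI1 surj_pair)
    then have cdm: "c < d" "d < verts Hs h" using T by auto
    then have less: "relocate (q a) (q b) k l (q c) < N" "relocate (q a) (q b) k l (q d) < N"
      using injmapsD(1)[OF q] qab kl by (auto intro!: relocate_less)
    have in_W: "relocate (q a) (q b) k l (q v) \<in> W"
      if v: "v \<in> {c, d}" "v \<noteq> a" "v \<noteq> b" for v
    proof -
      have "q v \<noteq> q a" "q v \<noteq> q b"
        using v cdm abm injmapsD(2)[OF q, of v a] injmapsD(2)[OF q, of v b] by auto
      moreover have "q v \<in> W" using VW[of v] v cd(2) by force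
      ultimately show ?thesis
        using relocate_apply(3)[OF qab(1) kl(1), of "q v"] abW by auto
    qed
    \<comment> \<open>Two different ordered edges cannot have the same endpoints, so one endpoint of
      \<open>cd\<close> avoids the distinguished edge and stays in \<open>W\<close>.\<close>
    have "c \<notin> {a, b} \<or> d \<notin> {a, b}" using cd cdm abm by auto
    then have "relocate (q a) (q b) k l (q c) \<in> W \<or> relocate (q a) (q b) k l (q d) \<in> W"
      using in_W by auto
    from entry_gvec_Int[OF less this S, of A]
    show "(case cd of (c, d) \<Rightarrow> entry (gvec (A \<inter> S)) ((relocate (q a) (q b) k l \<circ> q) c) ((relocate (q a) (q b) k l \<circ> q) d))
       = (case cd of (c, d) \<Rightarrow> entry (gvec A) ((relocate (q a) (q b) k l \<circ> q) c) ((relocate (q a) (q b) k l \<circ> q) d))"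
      by (simp add: cd(1))
  qed
  show ?thesis
    using *[of i j] *[of j i] ij by (simp add: z' e' ab' sample_value_def)
qed

text \<open>One list of samples has to serve all edges, so the empirical method runs on pairs of an
  edge and a graph, of total mass \<open>N choose 2\<close>. The cost of a sample is the number of
  vertices it sees, and Cauchy-Schwarz turns the mean-square bound into an \<open>L1\<close>
  bound.\<close>

lemma sampled_gradient:
  fixes P :: "(nat \<times> nat) set \<Rightarrow> real" and s :: nat
  assumes H: "\<forall>h\<in>set Hs. simple_graph (fst h)" and N: "N \<ge> 2" and s: "s \<ge> 1"
    and P0: "\<And>A. 0 \<le> P A" and P1: "(\<Sum>A\<in>Pow (edge_set N). P A) = 1"
  obtains S g where "S \<subseteq> edge_set N" "real (card S) \<le> 2 * real s * real N"
    "(\<Sum>A\<in>Pow (edge_set N). P A * (\<Sum>e\<in>edge_set N. \<bar>pdiff (subgraph_fun N Hs) e (gvec A) - g e (A \<inter> S)\<bar>))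
       \<le> C_beta Hs * sqrt (2 / real s) * real (N choose 2)"
proof -
  define n where "n = real (N choose 2)"
  define C where "C = C_beta Hs"
  have C: "C \<ge> 2" unfolding C_def by (rule C_beta_ge_2)
  have n0: "n > 0" using N by (simp add: n_def)
  define \<Omega> where "\<Omega> = edge_set N \<times> Pow (edge_set N)"
  define m where "m = (\<lambda>(e :: nat \<times> nat, A). P A)"
  define D where "D = (\<lambda>(e, A). pdiff (subgraph_fun N Hs) e (gvec A))"
  define v where "v = (\<lambda>z (e, A). sample_value Hs z e (gvec A))"
  have summ: "(\<Sum>x\<in>\<Omega>. m x) = n"
    unfolding \<Omega>_def m_def sum.cartesian_product[symmetric]
    by (simp add: P1 card_edge_set n_def)
  obtain zs where zs: "length zs \<le> s" "set zs \<subseteq> samples Hs N"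
    and le: "(\<Sum>x\<in>\<Omega>. m x * ((\<Sum>z\<leftarrow>zs. v z x) - real s * D x)\<^sup>2) + (C\<^sup>2 * n) * (\<Sum>z\<leftarrow>zs. real (card (sample_vertices Hs z)))
       \<le> real s * (C\<^sup>2 * (\<Sum>x\<in>\<Omega>. m x) + (C\<^sup>2 * n) *
           (\<Sum>z\<in>samples Hs N. sample_weight Hs N z * real (card (sample_vertices Hs z))))"
  \<comment> \<open>The multiplier \<open>l\<close> equals the variance bound of one step, so error
    and cost each raise the potential by at most \<open>C\<^sup>2 * n\<close> per step.\<close>
  proof (rule exE[OF empirical_approximation[where Z = "samples Hs N" and \<Omega> = \<Omega> and wt = "sample_weight Hs N"
          and m = m and D = D and v = v and b = C and n = s and l = "C\<^sup>2 * n"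
          and cost = "\<lambda>z. real (card (sample_vertices Hs z))"]])
    show "finite (samples Hs N)" by (rule finite_samples[OF H])
    show "0 \<le> sample_weight Hs N z" for z
      using falling_nonneg C_beta_ge_2[of Hs] by (simp add: sample_weight_def case_prod_beta)
    show "(\<Sum>z\<in>samples Hs N. sample_weight Hs N z) \<le> 1" by (rule sum_sample_weight_le_1[OF H])
    show "0 \<le> m x" for x using P0 by (simp add: m_def case_prod_beta)
    show "D x = (\<Sum>z\<in>samples Hs N. sample_weight Hs N z * v z x)" if "x \<in> \<Omega>" for x
      using that pdiff_as_average[OF H] by (auto simp: D_def v_def \<Omega>_def)
    show "\<bar>v z x\<bar> \<le> C" for z x
      using abs_sample_value_le by (simp add: v_def C_def case_prod_beta)
  qed (use that in blast)
  define Q where "Q = C\<^sup>2 * n"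
  define \<Phi> where "\<Phi> = (\<Sum>x\<in>\<Omega>. m x * ((\<Sum>z\<leftarrow>zs. v z x) - real s * D x)\<^sup>2)"
  define c where "c = (\<Sum>z\<leftarrow>zs. real (card (sample_vertices Hs z)))"
  have Q0: "Q > 0" using C n0 by (simp add: Q_def)
  have "\<Phi> + Q * c \<le> real s * (Q + Q * (\<Sum>z\<in>samples Hs N. sample_weight Hs N z * real (card (sample_vertices Hs z))))"
    using le by (simp add: \<Phi>_def Q_def c_def summ)
  also have "\<dots> \<le> real s * (Q + Q * 1)"
    using Q0 by (intro mult_left_mono add_left_mono sum_sample_vertices[OF H]) auto
  finally have tot: "\<Phi> + Q * c \<le> 2 * real s * Q" by simp
  \<comment> \<open>Both parts of the potential are nonnegative, so each one alone obeys the total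
    bound; this gives the mean-square error and the vertex count at once.\<close>
  have \<Phi>0: "\<Phi> \<ge> 0"
    unfolding \<Phi>_def using P0 by (intro sum_nonneg mult_nonneg_nonneg) (auto simp: m_def)
  have c0: "c \<ge> 0" unfolding c_def by (intro sum_list_nonneg) auto
  have \<Phi>le: "\<Phi> \<le> 2 * real s * Q" using tot Q0 c0 by (smt (verit) mult_nonneg_nonneg)
  have cle: "c \<le> 2 * real s"
  proof -
    have "Q * c \<le> Q * (2 * real s)" using tot \<Phi>0 by (simp add: mult_ac)
    then show ?thesis using Q0 by simp
  qed
  define W where "W = (\<Union>z\<in>set zs. sample_vertices Hs z)"
  define S where "S = {(i,j) \<in> edge_set N. i \<in> W \<or> j \<in> W}"
  \<comment> \<open>The division is by \<open>s\<close> and not by the length of \<open>zs\<close>: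
    steps that chose the zero vector still count as samples.\<close>
  define g where "g = (\<lambda>e A. (\<Sum>z\<leftarrow>zs. sample_value Hs z e (gvec A)) / real s)"
  have finV: "finite (sample_vertices Hs z)" if "z \<in> samples Hs N" for z
    using that finite_edges[OF edges_subset[OF H]] by (auto simp: samples_def sample_vertices_def)
  have finW: "finite W" unfolding W_def using finV zs(2) by auto
  have "real (card W) \<le> real (\<Sum>z\<leftarrow>zs. card (sample_vertices Hs z))"
    unfolding W_def of_nat_le_iff by (rule card_UN_list_le)
  also have "\<dots> = c"
    unfolding c_def by (induction zs) simp_all
  finally have cardW: "real (card W) \<le> 2 * real s" using cle by simp
  have "real (card S) \<le> real (card W) * real N"
    using card_incident_edges[OF finW S_def] by (metis of_nat_le_iff of_nat_mult)
  also have "\<dots> \<le> 2 * real s * real N" using cardW by (intro mult_right_mono) auto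
  finally have cardS: "real (card S) \<le> 2 * real s * real N" .
  have loc: "g e (A \<inter> S) = g e A" if "e \<in> edge_set N" for e A
    unfolding g_def
    by (intro arg_cong2[where f="(/)"] refl arg_cong[where f=sum_list] map_cong
        sample_value_local[OF H _ that _ S_def]) (use zs(2) in \<open>auto simp: W_def\<close>)
  have s0: "real s > 0" using s by simp
  have eq: "m x * (\<bar>D x - g (fst x) (snd x)\<bar>)\<^sup>2 = m x * ((\<Sum>z\<leftarrow>zs. v z x) - real s * D x)\<^sup>2 / (real s)\<^sup>2" for x
  proof -
    have "D x - g (fst x) (snd x) = - (((\<Sum>z\<leftarrow>zs. v z x) - real s * D x) / real s)"
      using s0 by (simp add: g_def v_def case_prod_beta field_simps)
    then show ?thesis by (simp add: power_divide)
  qed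
  have sq: "(\<Sum>x\<in>\<Omega>. m x * (\<bar>D x - g (fst x) (snd x)\<bar>)\<^sup>2) \<le> 2 * Q / real s"
  proof -
    have "(\<Sum>x\<in>\<Omega>. m x * (\<bar>D x - g (fst x) (snd x)\<bar>)\<^sup>2) = \<Phi> / (real s)\<^sup>2"
      unfolding eq \<Phi>_def sum_divide_distrib ..
    also have "\<dots> \<le> (2 * real s * Q) / (real s)\<^sup>2"
      by (intro divide_right_mono \<Phi>le) simp
    also have "\<dots> = 2 * Q / real s" using s0 by (simp add: power2_eq_square)
    finally show ?thesis .
  qed
  have m0: "m x \<ge> 0" for x using P0 by (simp add: m_def case_prod_beta)
  have "(\<Sum>x\<in>\<Omega>. m x * \<bar>D x - g (fst x) (snd x)\<bar>)\<^sup>2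
      = (\<Sum>x\<in>\<Omega>. sqrt (m x) * (sqrt (m x) * \<bar>D x - g (fst x) (snd x)\<bar>))\<^sup>2"
    using m0 by (simp add: mult.assoc[symmetric])
  also have "\<dots> \<le> (\<Sum>x\<in>\<Omega>. (sqrt (m x))\<^sup>2) * (\<Sum>x\<in>\<Omega>. (sqrt (m x) * \<bar>D x - g (fst x) (snd x)\<bar>)\<^sup>2)"
    by (rule Cauchy_Schwarz_ineq_sum)
  also have "\<dots> = n * (\<Sum>x\<in>\<Omega>. m x * (\<bar>D x - g (fst x) (snd x)\<bar>)\<^sup>2)"
    using m0 by (simp add: summ power_mult_distrib)
  also have "\<dots> \<le> n * (2 * Q / real s)"
    using n0 by (intro mult_left_mono sq) auto
  also have "\<dots> = (C * sqrt (2 / real s) * n)\<^sup>2"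
    using s0 by (simp add: Q_def power_mult_distrib power2_eq_square[of n])
  finally have "(\<Sum>x\<in>\<Omega>. m x * \<bar>D x - g (fst x) (snd x)\<bar>) \<le> C * sqrt (2 / real s) * n"
    by (rule power2_le_imp_le) (use C n0 in auto)
  also have "(\<Sum>x\<in>\<Omega>. m x * \<bar>D x - g (fst x) (snd x)\<bar>) =
      (\<Sum>A\<in>Pow (edge_set N). P A * (\<Sum>e\<in>edge_set N. \<bar>pdiff (subgraph_fun N Hs) e (gvec A) - g e A\<bar>))"
    unfolding \<Omega>_def m_def D_def sum_distrib_left
    by (subst sum.swap) (simp add: sum.cartesian_product case_prod_beta)
  also have "\<dots> = (\<Sum>A\<in>Pow (edge_set N). P A * (\<Sum>e\<in>edge_set N. \<bar>pdiff (subgraph_fun N Hs) e (gvec A) - g e (A \<inter> S)\<bar>))"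
    by (simp add: loc)
  finally show thesis
    by (intro that[of S g]) (auto simp: S_def cardS[unfolded S_def] C_def n_def)
qed

section \<open>The mean-field decomposition\<close>

lemma logistic_tanh: "(1 + tanh ((a - b) / 2)) / 2 = exp a / (exp a + exp b)" for a b :: real
proof -
  have "exp (- 2 * ((a - b) / 2)) = exp b / exp a"
    by (simp add: exp_diff[symmetric])
  then have "tanh ((a - b) / 2) = (1 - exp b / exp a) / (1 + exp b / exp a)"
    by (simp only: tanh_real_altdef)
  also have "1 - exp b / exp a = (exp a - exp b) / exp a"
    by (simp add: diff_divide_distrib)
  also have "1 + exp b / exp a = (exp a + exp b) / exp a"
    by (simp add: add_divide_distrib)
  also have "(exp a - exp b) / exp a / ((exp a + exp b) / exp a) = (exp a - exp b) / (exp a + exp b)"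
    by simp
  also have "(1 + (exp a - exp b) / (exp a + exp b)) / 2 = exp a / (exp a + exp b)"
  proof -
    have "exp a + exp b \<noteq> 0" using exp_gt_zero[of a] exp_gt_zero[of b] by linarith
    then show ?thesis by (simp add: field_simps)
  qed
  finally show ?thesis .
qed

lemma gvec_insert: "gvec (insert k B) = (gvec B)(k := 1)"
  and gvec_remove: "gvec (B - {k}) = (gvec B)(k := 0)"
  by (auto simp: gvec_def fun_eq_iff)

lemma pdiff_gvec: "pdiff f k (gvec B) = (f (gvec (insert k B)) - f (gvec (B - {k}))) / 2"
  by (simp add: pdiff_def gvec_insert gvec_remove)

lemma pdiff_gvec_insert: "pdiff f k (gvec (insert k B)) = pdiff f k (gvec (B - {k}))"
  by (simp add: pdiff_gvec)

lemma erg_prob_nonneg: "0 \<le> erg_prob N f A"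
  by (auto simp: erg_prob_def intro!: divide_nonneg_nonneg sum_nonneg)

lemma sum_erg_prob: "(\<Sum>A\<in>Pow (edge_set N). erg_prob N f A) = 1"
proof -
  have "(\<Sum>A\<in>Pow (edge_set N). exp (f (gvec A))) > 0"
    by (rule sum_pos) auto
  then show ?thesis
    by (simp add: erg_prob_def Pow_def flip: sum_divide_distrib)
qed

text \<open>Given the other edges, the odds of \<open>k\<close> are \<open>exp a\<close> to
  \<open>exp b\<close>. The factor 1/2 in \<open>pdiff\<close> is exactly what makes this a
  \<open>tanh\<close>; the partition function cancels.\<close>

lemma erg_prob_gibbs:
  assumes "k \<in> edge_set N" "B \<subseteq> edge_set N" "k \<notin> B"
  shows "erg_prob N f (insert k B) * (1 - (1 + tanh (pdiff f k (gvec B))) / 2)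
    = erg_prob N f B * ((1 + tanh (pdiff f k (gvec B))) / 2)"
proof -
  have "B - {k} = B" using assms by auto
  define a b where "a = f (gvec (insert k B))" and "b = f (gvec B)"
  have \<phi>: "(1 + tanh (pdiff f k (gvec B))) / 2 = exp a / (exp a + exp b)"
    by (simp only: pdiff_gvec \<open>B - {k} = B\<close> logistic_tanh a_def b_def)
  define Z where "Z = (\<Sum>G\<in>Pow (edge_set N). exp (f (gvec G)))"
  have eq: "exp a * (1 - exp a / (exp a + exp b)) = exp b * (exp a / (exp a + exp b))"
  proof -
    have "exp a + exp b \<noteq> 0" using exp_gt_zero[of a] exp_gt_zero[of b] by linarith
    then have "1 - exp a / (exp a + exp b) = exp b / (exp a + exp b)"
      by (simp add: field_simps)
    then show ?thesis by simp
  qed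
  have "erg_prob N f (insert k B) = exp a / Z" "erg_prob N f B = exp b / Z"
    using assms by (simp_all add: erg_prob_def a_def b_def Z_def)
  then show ?thesis
    unfolding \<phi> using eq by (simp only: times_divide_eq_left)
qed

lemma indep_prob_restrict: "indep_prob N (restrict p (edge_set N)) A = indep_prob N p A"
  by (auto simp: indep_prob_def intro!: prod.cong)

text \<open>The derivative at \<open>p\<close> is a mean over the first coordinate of the coupling,
  so the deviation from \<open>t\<close> is averaged over \<open>K\<close> and split by the triangle
  inequality at the second coordinate \<open>B\<close>. Here \<open>c\<close> is the total mass,
  since \<open>K\<close> lives on a single trace.\<close>

lemma mean_field_error:
  fixes K :: "(nat \<times> nat) set \<Rightarrow> (nat \<times> nat) set \<Rightarrow> real"
  assumes H: "\<forall>h\<in>set Hs. simple_graph (fst h)" and e: "e \<in> edge_set N"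
    and K0: "\<And>A B. 0 \<le> K A B"
    and K1: "\<And>A. A \<in> Pow (edge_set N) \<Longrightarrow> (\<Sum>B\<in>Pow (edge_set N). K A B) = c * indep_prob N p A"
    and c: "0 \<le> c"
  shows "c * \<bar>t - pdiff (subgraph_fun N Hs) e p\<bar> \<le> (\<Sum>A\<in>Pow (edge_set N). \<Sum>B\<in>Pow (edge_set N). K A B *
     (\<bar>pdiff (subgraph_fun N Hs) e (gvec B) - t\<bar> +
      \<bar>pdiff (subgraph_fun N Hs) e (gvec A) - pdiff (subgraph_fun N Hs) e (gvec B)\<bar>))"
proof -
  let ?d = "\<lambda>X. pdiff (subgraph_fun N Hs) e X"
  let ?E = "Pow (edge_set N)"
  have "c * (t - ?d p) = (\<Sum>A\<in>?E. c * indep_prob N p A * (t - ?d (gvec A)))"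
    using mean_pdiff[OF H e, of p] sum_indep_prob[of N p]
    by (simp add: right_diff_distrib sum_subtractf mult.assoc flip: sum_distrib_left sum_distrib_right)
  also have "\<dots> = (\<Sum>A\<in>?E. \<Sum>B\<in>?E. K A B * (t - ?d (gvec A)))"
    by (intro sum.cong refl) (simp add: K1 flip: sum_distrib_right)
  finally have eq: "c * (t - ?d p) = (\<Sum>A\<in>?E. \<Sum>B\<in>?E. K A B * (t - ?d (gvec A)))" .
  have "c * \<bar>t - ?d p\<bar> = \<bar>c * (t - ?d p)\<bar>"
    using c by (simp add: abs_mult)
  also have "\<dots> = \<bar>\<Sum>A\<in>?E. \<Sum>B\<in>?E. K A B * (t - ?d (gvec A))\<bar>"
    by (simp only: eq)
  also have "\<dots> \<le> (\<Sum>A\<in>?E. \<Sum>B\<in>?E. \<bar>K A B * (t - ?d (gvec A))\<bar>)"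
    by (intro order_trans[OF sum_abs] sum_mono) auto
  also have "\<dots> \<le> (\<Sum>A\<in>?E. \<Sum>B\<in>?E. K A B * (\<bar>?d (gvec B) - t\<bar> + \<bar>?d (gvec A) - ?d (gvec B)\<bar>))"
    using K0 by (intro sum_mono) (auto simp: abs_mult intro!: mult_left_mono)
  finally show ?thesis .
qed

text \<open>\<open>s\<close> is the number of samples and \<open>\<eta>\<close> bounds the
  \<open>L1\<close> error of the sampled gradient. In the coupling cost,
  \<open>2 * real s * real N\<close> pays for the exposed edges and \<open>\<eta> / 2\<close> for
  the estimate inside the 1/2-Lipschitz logistic function. In the fixed-point error,
  \<open>\<eta>\<close> is the estimation error on the Gibbs side, and the term with
  \<open>C_beta Hs / 12\<close> carries the gradient over to the product side.\<close>

lemma mean_field_structure: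
  assumes H: "\<forall>h\<in>set Hs. simple_graph (fst h)" and N: "N \<ge> 2" and s: "s \<ge> 1"
  defines "f \<equiv> subgraph_fun N Hs"
  defines "\<eta> \<equiv> C_beta Hs * sqrt (2 / real s) * real (N choose 2)"
  obtains p :: "(nat \<times> nat) set \<Rightarrow> nat \<times> nat \<Rightarrow> real" and K where
    "\<And>X. p X \<in> cube N"
    "\<And>A B. 0 \<le> K A B"
    "\<And>A. A \<in> Pow (edge_set N) \<Longrightarrow> (\<Sum>B\<in>Pow (edge_set N). K A B) =
        (\<Sum>X\<in>Pow (edge_set N). erg_prob N f X * indep_prob N (p X) A)"
    "\<And>B. B \<in> Pow (edge_set N) \<Longrightarrow> (\<Sum>A\<in>Pow (edge_set N). K A B) = erg_prob N f B"
    "(\<Sum>A\<in>Pow (edge_set N). \<Sum>B\<in>Pow (edge_set N). K A B * real (card (A - B \<union> (B - A))))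
        \<le> 2 * real s * real N + \<eta> / 2"
    "(\<Sum>X\<in>Pow (edge_set N). erg_prob N f X *
        (\<Sum>e\<in>edge_set N. \<bar>p X e - (1 + tanh (pdiff f e (p X))) / 2\<bar>))
        \<le> (\<eta> + C_beta Hs / 12 * (2 * real s * real N + \<eta> / 2)) / 2"
proof -
  let ?E = "edge_set N"
  let ?P = "Pow (edge_set N)"
  define P where "P = erg_prob N f"
  define d where "d = (\<lambda>e X. pdiff f e (gvec X))"
  have P0: "0 \<le> P X" for X by (simp add: P_def erg_prob_nonneg)
  have P1: "(\<Sum>X\<in>?P. P X) = 1" by (simp add: P_def sum_erg_prob)
  obtain S g where S: "S \<subseteq> ?E" "real (card S) \<le> 2 * real s * real N"
    and g: "(\<Sum>A\<in>?P. P A * (\<Sum>e\<in>?E. \<bar>d e A - g e (A \<inter> S)\<bar>)) \<le> \<eta>"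
  proof (rule sampled_gradient[OF H N s P0 P1])
    fix S g assume "S \<subseteq> ?E" "real (card S) \<le> 2 * real s * real N"
      "(\<Sum>A\<in>?P. P A * (\<Sum>e\<in>?E. \<bar>pdiff (subgraph_fun N Hs) e (gvec A) - g e (A \<inter> S)\<bar>))
        \<le> C_beta Hs * sqrt (2 / real s) * real (N choose 2)"
    then show thesis
      by (intro that[of S g]) (simp_all only: d_def f_def \<eta>_def)
  qed
  define \<phi> where "\<phi> = (\<lambda>e X. (1 + tanh (d e X)) / 2)"
  define q where "q = (\<lambda>e X. (1 + tanh (g e X)) / 2 :: real)"
  define p where "p = (\<lambda>X. restrict (\<lambda>e. q e (X \<inter> S)) ?E)"
  define \<kappa> where "\<kappa> = 2 * real s * real N + \<eta> / 2"
  have q01: "0 \<le> q e X" "q e X \<le> 1" for e X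
    using tanh_real_bounds[of "g e X"] by (auto simp: q_def)
  have finP: "finite ?P" "finite (Pow S)"
    using finite_subset[OF S(1)] by auto
  have \<phi>_ins: "\<phi> k (insert k B) = \<phi> k (B - {k})" for k B
    by (simp add: \<phi>_def d_def pdiff_gvec_insert)
  have gibbs: "P (insert k B) * (1 - \<phi> k B) = P B * \<phi> k B" if "k \<in> ?E" "B \<subseteq> ?E" "k \<notin> B" for k B
    using erg_prob_gibbs[OF that] by (simp add: P_def \<phi>_def d_def)
  from conditional_coupling[where w = P and \<phi> = \<phi> and q = q, OF finite_edge_set P0 gibbs \<phi>_ins q01 S(1)]
  obtain K where K0: "\<And>s A B. 0 \<le> K s A B"
    and K1: "\<And>s A. A \<in> ?P \<Longrightarrow> (\<Sum>B\<in>?P. K s A B) = (\<Sum>B\<in>?P. if B \<inter> S = s then P B else 0) *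
        (\<Prod>e\<in>?E. if e \<in> A then q e s else 1 - q e s)"
    and K2: "\<And>s B. B \<in> ?P \<Longrightarrow> (\<Sum>A\<in>?P. K s A B) = (if B \<inter> S = s then P B else 0)"
    and K3: "(\<Sum>s\<in>Pow S. \<Sum>A\<in>?P. \<Sum>B\<in>?P. K s A B * real (card (A - B \<union> (B - A))))
        \<le> (\<Sum>B\<in>?P. P B * (real (card S) + (\<Sum>e\<in>?E. \<bar>\<phi> e B - q e (B \<inter> S)\<bar>)))"
    by blast
  \<comment> \<open>\<open>c s\<close> is the probability that the exponential random graph has
    trace \<open>s\<close> on \<open>S\<close>.\<close>
  define c where "c = (\<lambda>s. \<Sum>B\<in>?P. if B \<inter> S = s then P B else 0)"
  have c0: "0 \<le> c s" for s unfolding c_def by (intro sum_nonneg) (auto simp: P0)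
  define ps where "ps = (\<lambda>s. restrict (\<lambda>e. q e s) ?E)"
  have p_ps: "p X = ps (X \<inter> S)" for X by (simp add: p_def ps_def)
  have K1': "(\<Sum>B\<in>?P. K s A B) = c s * indep_prob N (ps s) A" if "A \<in> ?P" for s A
    using that by (simp add: K1 c_def ps_def indep_prob_restrict) (simp add: indep_prob_def)
  have by_trace: "(\<Sum>s\<in>Pow S. c s * F s) = (\<Sum>X\<in>?P. P X * F (X \<inter> S))" for F
  proof -
    have "(\<Sum>s\<in>Pow S. c s * F s) = (\<Sum>X\<in>?P. \<Sum>s\<in>Pow S. if X \<inter> S = s then P X * F s else 0)"
      unfolding c_def sum_distrib_right by (subst sum.swap) (auto intro!: sum.cong)
    also have "\<dots> = (\<Sum>X\<in>?P. P X * F (X \<inter> S))"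
      using finP by (intro sum.cong refl) (simp add: sum.delta')
    finally show ?thesis .
  qed
  have lip: "\<bar>(1 + tanh x) / 2 - (1 + tanh y) / 2\<bar> \<le> \<bar>x - y\<bar> / 2" for x y :: real
    using tanh_lipschitz[of x y] by (simp add: diff_divide_distrib[symmetric])
  define cost where "cost = (\<Sum>s\<in>Pow S. \<Sum>A\<in>?P. \<Sum>B\<in>?P. K s A B * real (card (A - B \<union> (B - A))))"
  have "cost \<le> (\<Sum>B\<in>?P. P B * (real (card S) + (\<Sum>e\<in>?E. \<bar>d e B - g e (B \<inter> S)\<bar> / 2)))"
    unfolding cost_def
    by (rule order_trans[OF K3]) (intro sum_mono mult_left_mono add_left_mono P0, simp only: \<phi>_def q_def, rule lip)
  also have "\<dots> = real (card S) + (\<Sum>B\<in>?P. P B * (\<Sum>e\<in>?E. \<bar>d e B - g e (B \<inter> S)\<bar>)) / 2"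
    by (simp add: distrib_left sum.distrib P1 flip: sum_distrib_right sum_divide_distrib)
  also have "\<dots> \<le> \<kappa>" unfolding \<kappa>_def using S(2) g by simp
  finally have cost_le: "cost \<le> \<kappa>" .
  define err where "err = (\<lambda>s. \<Sum>e\<in>?E. \<bar>g e s - pdiff f e (ps s)\<bar>)"
  have "(\<Sum>s\<in>Pow S. c s * err s) \<le> (\<Sum>s\<in>Pow S. \<Sum>A\<in>?P. \<Sum>B\<in>?P. K s A B *
     ((\<Sum>e\<in>?E. \<bar>d e B - g e s\<bar>) + C_beta Hs / 12 * real (card (A - B \<union> (B - A)))))"
  proof (rule sum_mono)
    fix s assume "s \<in> Pow S"
    have "c s * err s \<le> (\<Sum>e\<in>?E. \<Sum>A\<in>?P. \<Sum>B\<in>?P. K s A B * (\<bar>d e B - g e s\<bar> + \<bar>d e A - d e B\<bar>))"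
      unfolding err_def sum_distrib_left d_def f_def
      by (intro sum_mono mean_field_error H K0 K1' c0)
    also have "\<dots> = (\<Sum>A\<in>?P. \<Sum>B\<in>?P. \<Sum>e\<in>?E. K s A B * (\<bar>d e B - g e s\<bar> + \<bar>d e A - d e B\<bar>))"
      by (simp only: sum.swap[of _ _ ?E])
    also have "\<dots> = (\<Sum>A\<in>?P. \<Sum>B\<in>?P. K s A B * ((\<Sum>e\<in>?E. \<bar>d e B - g e s\<bar>) + (\<Sum>e\<in>?E. \<bar>d e A - d e B\<bar>)))"
      by (simp only: sum_distrib_left[symmetric] sum.distrib)
    also have "\<dots> \<le> (\<Sum>A\<in>?P. \<Sum>B\<in>?P. K s A B *
        ((\<Sum>e\<in>?E. \<bar>d e B - g e s\<bar>) + C_beta Hs / 12 * real (card (A - B \<union> (B - A)))))"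
      unfolding d_def f_def by (intro sum_mono mult_left_mono add_left_mono pdiff_lipschitz H N K0) auto
    finally show "c s * err s \<le> (\<Sum>A\<in>?P. \<Sum>B\<in>?P. K s A B *
        ((\<Sum>e\<in>?E. \<bar>d e B - g e s\<bar>) + C_beta Hs / 12 * real (card (A - B \<union> (B - A)))))" .
  qed
  also have "\<dots> = (\<Sum>s\<in>Pow S. \<Sum>A\<in>?P. \<Sum>B\<in>?P. K s A B * (\<Sum>e\<in>?E. \<bar>d e B - g e s\<bar>)) + C_beta Hs / 12 * cost"
    unfolding cost_def sum_distrib_left distrib_left sum.distrib
    by (simp add: mult.left_commute)
  also have "(\<Sum>s\<in>Pow S. \<Sum>A\<in>?P. \<Sum>B\<in>?P. K s A B * (\<Sum>e\<in>?E. \<bar>d e B - g e s\<bar>))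
     = (\<Sum>B\<in>?P. P B * (\<Sum>e\<in>?E. \<bar>d e B - g e (B \<inter> S)\<bar>))"
  proof -
    have "(\<Sum>s\<in>Pow S. \<Sum>A\<in>?P. \<Sum>B\<in>?P. K s A B * (\<Sum>e\<in>?E. \<bar>d e B - g e s\<bar>))
      = (\<Sum>s\<in>Pow S. \<Sum>B\<in>?P. \<Sum>A\<in>?P. K s A B * (\<Sum>e\<in>?E. \<bar>d e B - g e s\<bar>))"
      by (rule sum.cong[OF refl], rule sum.swap)
    also have "\<dots> = (\<Sum>s\<in>Pow S. \<Sum>B\<in>?P. if B \<inter> S = s then P B * (\<Sum>e\<in>?E. \<bar>d e B - g e s\<bar>) else 0)"
      by (intro sum.cong refl) (simp add: K2 flip: sum_distrib_right)
    also have "\<dots> = (\<Sum>B\<in>?P. \<Sum>s\<in>Pow S. if B \<inter> S = s then P B * (\<Sum>e\<in>?E. \<bar>d e B - g e s\<bar>) else 0)"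
      by (rule sum.swap)
    also have "\<dots> = (\<Sum>B\<in>?P. P B * (\<Sum>e\<in>?E. \<bar>d e B - g e (B \<inter> S)\<bar>))"
      using finP by (intro sum.cong refl) (simp add: sum.delta')
    finally show ?thesis .
  qed
  also have "\<dots> + C_beta Hs / 12 * cost \<le> \<eta> + C_beta Hs / 12 * \<kappa>"
    using C_beta_ge_2[of Hs] by (intro add_mono g mult_left_mono cost_le) auto
  finally have err_le: "(\<Sum>X\<in>?P. P X * err (X \<inter> S)) \<le> \<eta> + C_beta Hs / 12 * \<kappa>"
    by (simp only: by_trace)
  show thesis
  \<comment> \<open>Adding the couplings over all traces undoes the conditioning: the first marginal
    becomes a mixture of product measures and the second the full Gibbs law.\<close>
  proof (rule that[of p "\<lambda>A B. \<Sum>s\<in>Pow S. K s A B"])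
    show "p X \<in> cube N" for X
      using q01 by (auto simp: p_def cube_def)
    show "0 \<le> (\<Sum>s\<in>Pow S. K s A B)" for A B by (intro sum_nonneg K0)
    show "(\<Sum>B\<in>?P. \<Sum>s\<in>Pow S. K s A B) = (\<Sum>X\<in>?P. erg_prob N f X * indep_prob N (p X) A)" if "A \<in> ?P" for A
      by (subst sum.swap) (simp add: K1'[OF that] by_trace p_ps P_def)
    show "(\<Sum>A\<in>?P. \<Sum>s\<in>Pow S. K s A B) = erg_prob N f B" if "B \<in> ?P" for B
      using finP by (subst sum.swap) (simp add: K2[OF that] sum.delta' P_def)
    have "(\<Sum>A\<in>?P. \<Sum>B\<in>?P. (\<Sum>s\<in>Pow S. K s A B) * real (card (A - B \<union> (B - A)))) = cost"
      unfolding cost_def sum_distrib_right by (simp only: sum.swap[of _ _ "Pow S"])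
    then show "(\<Sum>A\<in>?P. \<Sum>B\<in>?P. (\<Sum>s\<in>Pow S. K s A B) * real (card (A - B \<union> (B - A)))) \<le> 2 * real s * real N + \<eta> / 2"
      using cost_le by (simp add: \<kappa>_def)
    have "(\<Sum>X\<in>?P. P X * (\<Sum>e\<in>?E. \<bar>p X e - (1 + tanh (pdiff f e (p X))) / 2\<bar>))
        \<le> (\<Sum>X\<in>?P. P X * (err (X \<inter> S) / 2))"
    proof (intro sum_mono mult_left_mono P0)
      fix X
      show "(\<Sum>e\<in>?E. \<bar>p X e - (1 + tanh (pdiff f e (p X))) / 2\<bar>) \<le> err (X \<inter> S) / 2"
        unfolding err_def sum_divide_distrib
      proof (rule sum_mono)
        fix e assume "e \<in> ?E"
        then have "p X e = (1 + tanh (g e (X \<inter> S))) / 2" by (simp add: p_def q_def)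
        then show "\<bar>p X e - (1 + tanh (pdiff f e (p X))) / 2\<bar> \<le> \<bar>g e (X \<inter> S) - pdiff f e (ps (X \<inter> S))\<bar> / 2"
          using lip by (simp only: p_ps)
      qed
    qed
    also have "\<dots> = (\<Sum>X\<in>?P. P X * err (X \<inter> S)) / 2"
      by (simp add: sum_divide_distrib)
    also have "\<dots> \<le> (\<eta> + C_beta Hs / 12 * (2 * real s * real N + \<eta> / 2)) / 2"
      using err_le by (simp add: \<kappa>_def)
    finally show "(\<Sum>X\<in>?P. erg_prob N f X * (\<Sum>e\<in>?E. \<bar>p X e - (1 + tanh (pdiff f e (p X))) / 2\<bar>))
        \<le> (\<eta> + C_beta Hs / 12 * (2 * real s * real N + \<eta> / 2)) / 2"
      by (simp add: P_def)
  qed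
qed

section \<open>From finite weights to probability measures, and measurability\<close>

lemma pmf_of_finite_weights:
  fixes w :: "'a \<Rightarrow> real"
  assumes "finite A" "\<And>x. 0 \<le> w x" "\<And>x. x \<notin> A \<Longrightarrow> w x = 0" "(\<Sum>x\<in>A. w x) = 1"
  obtains M where "\<And>x. pmf M x = w x" "set_pmf M \<subseteq> A"
proof -
  have "(\<integral>\<^sup>+x. ennreal (w x) \<partial>count_space UNIV) = (\<Sum>x\<in>A. ennreal (w x))"
    by (rule nn_integral_count_space') (use assms in auto)
  also have "\<dots> = 1"
    using assms by (simp add: sum_ennreal)
  finally have nn: "(\<integral>\<^sup>+x. ennreal (w x) \<partial>count_space UNIV) = 1" .
  have pmf: "pmf (embed_pmf w) x = w x" for x
    by (rule pmf_embed_pmf[OF assms(2) nn])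
  show thesis
  proof (rule that[of "embed_pmf w"])
    show "set_pmf (embed_pmf w) \<subseteq> A"
      using pmf assms(3) by (force simp: set_pmf_eq)
  qed (rule pmf)
qed

lemma pmf_map_finite:
  assumes "finite A" "set_pmf \<mu> \<inter> f -` {y} \<subseteq> A" "A \<subseteq> f -` {y}"
  shows "pmf (map_pmf f \<mu>) y = (\<Sum>x\<in>A. pmf \<mu> x)"
proof -
  have "pmf (map_pmf f \<mu>) y = measure \<mu> (f -` {y})"
    by (rule pmf_map)
  also have "\<dots> = measure \<mu> (f -` {y} \<inter> set_pmf \<mu>)"
    by (simp add: measure_Int_set_pmf)
  also have "f -` {y} \<inter> set_pmf \<mu> = A \<inter> set_pmf \<mu>" using assms by auto
  also have "measure \<mu> \<dots> = measure \<mu> A"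
    by (simp add: measure_Int_set_pmf)
  also have "\<dots> = (\<Sum>x\<in>A. pmf \<mu> x)"
    by (rule measure_measure_pmf_finite[OF assms(1)])
  finally show ?thesis .
qed

lemma entry_upd_measurable:
  assumes "x < N" "y < N"
  shows "(\<lambda>X. entry (X(e := c)) x y) \<in> borel_measurable (PiM (edge_set N) (\<lambda>_. borel))"
proof -
  have *: "(\<lambda>X. (X(e := c)) e') \<in> borel_measurable (PiM (edge_set N) (\<lambda>_. borel))" if "e' \<in> edge_set N" for e'
    using that by (cases "e' = e") (auto intro: measurable_component_singleton)
  show ?thesis
    using assms *[of "(x,y)"] *[of "(y,x)"]
    by (cases x y rule: linorder_cases) (auto simp: entry_def edge_set_def)
qed

lemma pdiff_measurable:
  assumes H: "\<forall>h\<in>set Hs. simple_graph (fst h)"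
  shows "(\<lambda>X. pdiff (subgraph_fun N Hs) e X) \<in> borel_measurable (PiM (edge_set N) (\<lambda>_. borel))"
proof -
  have *: "(\<lambda>X. subgraph_fun N Hs (X(e := c))) \<in> borel_measurable (PiM (edge_set N) (\<lambda>_. borel))" for c
    unfolding subgraph_fun_alt edge_product_def
  proof (intro borel_measurable_sum borel_measurable_times borel_measurable_const borel_measurable_prod)
    fix h q cd assume "h \<in> {..<length Hs}" and q: "q \<in> injmaps (verts Hs h) N" and cd: "cd \<in> edges Hs h"
    then have "edges Hs h \<subseteq> {(a,b). a < b \<and> b < verts Hs h}" using edges_subset[OF H] by simp
    with cd obtain c' d where "cd = (c', d)" "c' < verts Hs h" "d < verts Hs h" by auto
    then show "(\<lambda>X. case cd of (l, l') \<Rightarrow> entry (X(e := c)) (q l) (q l')) \<in> borel_measurable (PiM (edge_set N) (\<lambda>_. borel))"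
      using entry_upd_measurable[of "q c'" N "q d"] injmapsD(1)[OF q] by simp
  qed
  show ?thesis
    unfolding pdiff_def using *[of 0] *[of 1] by measurable
qed

lemma cube_sets: "cube N \<in> sets (PiM (edge_set N) (\<lambda>_. borel))"
  unfolding cube_def by (rule sets_PiM_I_finite) auto

lemma tanh_measurable: "(tanh :: real \<Rightarrow> real) \<in> borel_measurable borel"
  by (intro borel_measurable_continuous_onI continuous_on_tanh continuous_on_id) auto

lemma fixed_point_error_measurable:
  assumes H: "\<forall>h\<in>set Hs. simple_graph (fst h)"
  shows "(\<lambda>X. \<Sum>e\<in>edge_set N. \<bar>X e - (1 + tanh (pdiff (subgraph_fun N Hs) e X)) / 2\<bar>)
    \<in> borel_measurable (PiM (edge_set N) (\<lambda>_. borel))"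
proof (rule borel_measurable_sum)
  fix e assume e: "e \<in> edge_set N"
  have "(\<lambda>X. tanh (pdiff (subgraph_fun N Hs) e X)) \<in> borel_measurable (PiM (edge_set N) (\<lambda>_. borel))"
    by (rule measurable_compose[OF pdiff_measurable[OF H] tanh_measurable])
  moreover have "(\<lambda>X. X e) \<in> borel_measurable (PiM (edge_set N) (\<lambda>_. borel))"
    by (rule measurable_component_singleton[OF e])
  ultimately show "(\<lambda>X. \<bar>X e - (1 + tanh (pdiff (subgraph_fun N Hs) e X)) / 2\<bar>)
    \<in> borel_measurable (PiM (edge_set N) (\<lambda>_. borel))"
    by measurable
qed

lemma X_f_sets:
  assumes H: "\<forall>h\<in>set Hs. simple_graph (fst h)"
  shows "X_f N (subgraph_fun N Hs) C \<in> sets (PiM (edge_set N) (\<lambda>_. borel))"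
proof -
  let ?M = "PiM (edge_set N) (\<lambda>_. borel :: real measure)"
  let ?err = "\<lambda>X. \<Sum>e\<in>edge_set N. \<bar>X e - (1 + tanh (pdiff (subgraph_fun N Hs) e X)) / 2\<bar>"
  have le: "{X \<in> space ?M. ?err X \<le> 5000 * C ^ 2 * real (N choose 2) powr (15/16)} \<in> sets ?M"
    by (rule borel_measurable_le[OF fixed_point_error_measurable[OF H] borel_measurable_const])
  have eq: "X_f N (subgraph_fun N Hs) C = cube N \<inter>
      {X \<in> space ?M. ?err X \<le> 5000 * C ^ 2 * real (N choose 2) powr (15/16)}"
    using sets.sets_into_space[OF cube_sets[of N]] by (auto simp: X_f_def)
  show ?thesis unfolding eq by (rule sets.Int[OF cube_sets le])
qed

lemma indep_prob_measurable: "(\<lambda>p. indep_prob N p G) \<in> borel_measurable (PiM (edge_set N) (\<lambda>_. borel))"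
proof (cases "G \<subseteq> edge_set N")
  case True
  have "(\<lambda>p. \<Prod>e\<in>edge_set N. if e \<in> G then p e else 1 - p e) \<in> borel_measurable (PiM (edge_set N) (\<lambda>_. borel :: real measure))"
  proof (rule borel_measurable_prod)
    fix e assume e: "e \<in> edge_set N"
    have "(\<lambda>X. X e) \<in> borel_measurable (PiM (edge_set N) (\<lambda>_. borel :: real measure))"
      by (rule measurable_component_singleton[OF e])
    then show "(\<lambda>p. if e \<in> G then p e else 1 - p e) \<in> borel_measurable (PiM (edge_set N) (\<lambda>_. borel :: real measure))"
      by (cases "e \<in> G") simp_all
  qed
  then show ?thesis using True by (simp add: indep_prob_def)
qed (simp add: indep_prob_def)

text \<open>All quantities are measured in \<open>x\<close>, the 16th root of \<open>n\<close>. As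
  \<open>N\<close> is at most \<open>2 * x ^ 8\<close>, about \<open>x ^ 6\<close> samples expose
  \<open>O(x ^ 14)\<close> edges and leave a gradient error of order \<open>C * x ^ 13\<close>,
  which the looser \<open>x ^ 14\<close> covers.\<close>

lemma sample_size_bounds:
  assumes N: "N \<ge> 2" and C: "C \<ge> 2"
  defines "n \<equiv> real (N choose 2)"
  defines "x \<equiv> n powr (1/16)"
  obtains s :: nat where "s \<ge> 1" "2 * real s * real N + (C * sqrt (2 / real s) * n) / 2 \<le> 5 * C * x ^ 14"
    "C * sqrt (2 / real s) * n \<le> 2 * C * x ^ 14"
    "x \<ge> 1"
proof -
  have "2 * (N choose 2) = N * (N - 1)"
    unfolding choose_two by (rule dvd_mult_div_cancel) (cases N, auto)
  then have "2 * n = real (N * (N - 1))" unfolding n_def by (metis of_nat_mult of_nat_numeral)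
  also have "\<dots> = real N * (real N - 1)" using N by (simp add: of_nat_diff)
  finally have n2: "2 * n = real N * (real N - 1)" .
  have N2: "real N \<ge> 2" using N by simp
  have "real N * (real N - 1) \<ge> 2 * 1" using N2 by (intro mult_mono) auto
  then have n1: "n \<ge> 1" using n2 by simp
  then have x1: "x \<ge> 1" unfolding x_def by (simp add: ge_one_powr_ge_zero)
  have xn: "x ^ 16 = n" unfolding x_def using n1 by (simp add: powr_powr flip: powr_realpow)
  have "(real N)\<^sup>2 \<le> 4 * n"
    using n2 mult_left_mono[OF N2, of "real N"] by (simp add: power2_eq_square algebra_simps)
  also have "\<dots> = (2 * x ^ 8)\<^sup>2" by (simp add: power_mult_distrib flip: xn power_mult)
  finally have Nx: "real N \<le> 2 * x ^ 8"
    by (rule power2_le_imp_le) (use x1 in simp)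
  define s where "s = nat \<lceil>x ^ 6\<rceil>"
  have x6: "x ^ 6 \<ge> 1" using x1 by (rule one_le_power)
  have s_ge: "real s \<ge> x ^ 6" unfolding s_def by (rule real_nat_ceiling_ge)
  \<comment> \<open>Rounding up costs at most 1, which is below \<open>x ^ 6\<close>.\<close>
  have s_le: "real s \<le> 2 * x ^ 6" unfolding s_def using x6 by linarith
  have s1: "s \<ge> 1" using s_ge x6 by linarith
  have "2 * real s * real N \<le> 2 * (2 * x ^ 6) * (2 * x ^ 8)"
    using x1 by (intro mult_mono s_le Nx) auto
  then have a: "2 * real s * real N \<le> 8 * x ^ 14" by (simp flip: power_add)
  have "sqrt (2 / real s) \<le> 2 / x ^ 3"
  proof (rule real_le_lsqrt)
    have "2 / real s \<le> 2 / x ^ 6" using s_ge x6 by (intro divide_left_mono mult_pos_pos) auto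
    also have "\<dots> \<le> 4 / x ^ 6" using x6 by (intro divide_right_mono) auto
    also have "\<dots> = (2 / x ^ 3)\<^sup>2" by (simp add: power_divide flip: power_mult)
    finally show "2 / real s \<le> (2 / x ^ 3)\<^sup>2" .
  qed (use x1 in auto)
  then have "C * sqrt (2 / real s) * n \<le> C * (2 / x ^ 3) * x ^ 16"
    using C n1 xn x1 by (intro mult_mono) auto
  also have "\<dots> = 2 * C * x ^ 13"
    using x1 by (simp add: power_eq_if[of x 16] field_simps eval_nat_numeral)
  also have "\<dots> \<le> 2 * C * x ^ 14"
    using x1 C by (intro mult_left_mono power_increasing) auto
  finally have b: "C * sqrt (2 / real s) * n \<le> 2 * C * x ^ 14" .
  have "8 * x ^ 14 \<le> 4 * C * x ^ 14" using x1 C by (intro mult_right_mono) auto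
  with a b have "2 * real s * real N + (C * sqrt (2 / real s) * n) / 2 \<le> 5 * C * x ^ 14" by linarith
  from that[OF s1 this b x1] show thesis .
qed

section \<open>The mixing measure and the final estimates\<close>

theorem theorem10:
  fixes N :: nat and Hs :: "((nat \<times> (nat \<times> nat) set) \<times> real) list"
  assumes "N \<ge> 2"
    and "\<forall>h\<in>set Hs. simple_graph (fst h)"
  shows "\<exists>\<rho> :: ((nat \<times> nat) \<Rightarrow> real) measure.
     prob_space \<rho> \<and>
     sets \<rho> = sets (PiM (edge_set N) (\<lambda>_. borel)) \<and>
     measure \<rho> (cube N) = 1 \<and>
     is_mixture N \<rho> (80 * C_beta Hs * real (N choose 2) powr (-1/16))
        (erg_prob N (subgraph_fun N Hs)) \<and>
     measure \<rho> (X_f N (subgraph_fun N Hs) (C_beta Hs))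
        \<ge> 1 - 80 * C_beta Hs / real (N choose 2) powr (1/16)"
proof -
  let ?P = "Pow (edge_set N)"
  let ?M = "PiM (edge_set N) (\<lambda>_. borel :: real measure)"
  define f where "f = subgraph_fun N Hs"
  define C where "C = C_beta Hs"
  define n where "n = real (N choose 2)"
  define x where "x = n powr (1/16)"
  have C: "C \<ge> 2" unfolding C_def by (rule C_beta_ge_2)
  obtain s where s: "s \<ge> 1" and cost_bd: "2 * real s * real N + (C * sqrt (2 / real s) * n) / 2 \<le> 5 * C * x ^ 14"
    and eta_bd: "C * sqrt (2 / real s) * n \<le> 2 * C * x ^ 14" and x1: "x \<ge> 1"
    using sample_size_bounds[OF assms(1) C] unfolding x_def n_def by blast
  have n0: "n > 0"
    using assms(1) by (simp add: n_def)
  have xn: "n powr (15/16) = x ^ 15" "n powr (-1/16) = 1 / x" "n = x ^ 16"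
    using n0 by (simp_all add: x_def powr_powr powr_minus_divide flip: powr_realpow)
  obtain p K where p_cube: "\<And>X. p X \<in> cube N"
    and K0: "\<And>A B. 0 \<le> K A B"
    and K1: "\<And>A. A \<in> ?P \<Longrightarrow> (\<Sum>B\<in>?P. K A B) = (\<Sum>X\<in>?P. erg_prob N f X * indep_prob N (p X) A)"
    and K2: "\<And>B. B \<in> ?P \<Longrightarrow> (\<Sum>A\<in>?P. K A B) = erg_prob N f B"
    and K3: "(\<Sum>A\<in>?P. \<Sum>B\<in>?P. K A B * real (card (A - B \<union> (B - A))))
        \<le> 2 * real s * real N + (C * sqrt (2 / real s) * n) / 2"
    and err: "(\<Sum>X\<in>?P. erg_prob N f X * (\<Sum>e\<in>edge_set N. \<bar>p X e - (1 + tanh (pdiff f e (p X))) / 2\<bar>))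
        \<le> (C * sqrt (2 / real s) * n + C / 12 * (2 * real s * real N + (C * sqrt (2 / real s) * n) / 2)) / 2"
    using mean_field_structure[OF assms(2,1) s] unfolding f_def C_def n_def by blast
  obtain G where G: "\<And>X. pmf G X = erg_prob N f X" "set_pmf G \<subseteq> ?P"
  proof (rule pmf_of_finite_weights[of ?P "erg_prob N f"])
    show "erg_prob N f X = 0" if "X \<notin> ?P" for X using that by (simp add: erg_prob_def)
    show thesis if "\<And>X. pmf M X = erg_prob N f X" "set_pmf M \<subseteq> ?P" for M
      using that by (rule \<open>\<And>G. (\<And>X. pmf G X = erg_prob N f X) \<Longrightarrow> set_pmf G \<subseteq> ?P \<Longrightarrow> thesis\<close>)
  qed (simp_all add: erg_prob_nonneg sum_erg_prob)
  have p_space: "p X \<in> space ?M" for X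
    using p_cube sets.sets_into_space[OF cube_sets[of N]] by blast
  have p_meas: "p \<in> measurable (measure_pmf G) ?M"
    unfolding measurable_pmf_measure1 using p_space by blast
  \<comment> \<open>The mixing measure is the law of \<open>p X\<close> when \<open>X\<close> is the
    exponential random graph itself.\<close>
  define \<rho> where "\<rho> = distr (measure_pmf G) ?M p"
  have prob: "prob_space \<rho>"
    unfolding \<rho>_def by (rule measure_pmf.prob_space_distr[OF p_meas])
  have sets_\<rho>: "sets \<rho> = sets ?M" by (simp add: \<rho>_def)
  have meas_\<rho>: "measure \<rho> A = measure_pmf.prob G {X. p X \<in> A}" if "A \<in> sets ?M" for A
    unfolding \<rho>_def by (subst measure_distr[OF p_meas that]) (simp add: vimage_def)
  have mix: "mix_prob N \<rho> A = (\<Sum>X\<in>?P. erg_prob N f X * indep_prob N (p X) A)" for A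
  proof -
    have "mix_prob N \<rho> A = (\<integral>X. indep_prob N (p X) A \<partial>measure_pmf G)"
      unfolding mix_prob_def \<rho>_def by (rule integral_distr[OF p_meas indep_prob_measurable])
    also have "\<dots> = (\<Sum>X\<in>?P. indep_prob N (p X) A * pmf G X)"
      by (rule integral_measure_pmf_real) (use G in auto)
    finally show ?thesis by (simp add: G mult.commute)
  qed
  have mixture: "is_mixture N \<rho> (80 * C * n powr (-1/16)) (erg_prob N f)"
  proof -
    \<comment> \<open>\<open>K\<close> is controlled only on subsets of the edge set, so it is cut
      off elsewhere.\<close>
    define w where "w = (\<lambda>(A, B). if A \<in> ?P \<and> B \<in> ?P then K A B else 0)"
    obtain \<mu> where \<mu>: "\<And>ab. pmf \<mu> ab = w ab" "set_pmf \<mu> \<subseteq> ?P \<times> ?P"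
    proof (rule pmf_of_finite_weights[of "?P \<times> ?P" w])
      show "finite (?P \<times> ?P)" by simp
      show "0 \<le> w ab" for ab using K0 by (auto simp: w_def split: prod.split)
      show "w ab = 0" if "ab \<notin> ?P \<times> ?P" for ab using that by (auto simp: w_def split: prod.split)
      have "(\<Sum>ab\<in>?P \<times> ?P. w ab) = (\<Sum>A\<in>?P. \<Sum>B\<in>?P. K A B)"
        unfolding sum.cartesian_product by (rule sum.cong) (auto simp: w_def)
      also have "\<dots> = (\<Sum>B\<in>?P. \<Sum>A\<in>?P. K A B)" by (rule sum.swap)
      also have "\<dots> = 1" by (simp add: K2 sum_erg_prob)
      finally show "(\<Sum>ab\<in>?P \<times> ?P. w ab) = 1" .
    qed (use that in blast)
    have "pmf (map_pmf fst \<mu>) A = mix_prob N \<rho> A" for A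
    proof (cases "A \<in> ?P")
      case True
      have "pmf (map_pmf fst \<mu>) A = (\<Sum>ab\<in>{A} \<times> ?P. pmf \<mu> ab)"
        by (rule pmf_map_finite) (use \<mu>(2) in auto)
      also have "\<dots> = (\<Sum>B\<in>?P. K A B)"
        using True by (simp add: \<mu>(1) w_def flip: sum.cartesian_product)
      finally show ?thesis using K1[OF True] mix by simp
    next
      case False
      then have "pmf (map_pmf fst \<mu>) A = 0"
        using \<mu>(2) by (auto simp: pmf_eq_0_set_pmf)
      moreover have "indep_prob N (p X) A = 0" for X using False by (simp add: indep_prob_def)
      ultimately show ?thesis by (simp add: mix)
    qed
    moreover have "pmf (map_pmf snd \<mu>) B = erg_prob N f B" for B
    proof (cases "B \<in> ?P")
      case True
      have "pmf (map_pmf snd \<mu>) B = (\<Sum>ab\<in>?P \<times> {B}. pmf \<mu> ab)"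
        by (rule pmf_map_finite) (use \<mu>(2) in auto)
      also have "\<dots> = (\<Sum>A\<in>?P. K A B)"
        using True by (simp add: \<mu>(1) w_def flip: sum.cartesian_product)
      finally show ?thesis using K2[OF True] by simp
    next
      case False
      then have "pmf (map_pmf snd \<mu>) B = 0"
        using \<mu>(2) by (auto simp: pmf_eq_0_set_pmf)
      then show ?thesis using False by (simp add: erg_prob_def)
    qed
    moreover have "measure_pmf.expectation \<mu> (\<lambda>(A,B). real (card (A - B \<union> (B - A)))) \<le> 80 * C * n powr (-1/16) * n"
    proof -
      have "measure_pmf.expectation \<mu> (\<lambda>(A,B). real (card (A - B \<union> (B - A))))
          = (\<Sum>ab\<in>?P \<times> ?P. (case ab of (A, B) \<Rightarrow> real (card (A - B \<union> (B - A)))) * pmf \<mu> ab)"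
        by (rule integral_measure_pmf_real) (use \<mu>(2) in auto)
      also have "\<dots> = (\<Sum>A\<in>?P. \<Sum>B\<in>?P. K A B * real (card (A - B \<union> (B - A))))"
        unfolding sum.cartesian_product by (rule sum.cong) (auto simp: \<mu>(1) w_def)
      also have "\<dots> \<le> 5 * C * x ^ 14" using K3 cost_bd by simp
      also have "\<dots> \<le> 80 * C * x ^ 15"
        using x1 C by (intro mult_mono power_increasing) auto
      also have "\<dots> = 80 * C * n powr (-1/16) * n"
      proof -
        have "n = x * x ^ 15" unfolding xn(3) by (simp flip: power_Suc)
        then have "1 / x * n = x ^ 15" using x1 by simp
        then show ?thesis unfolding xn(2) by (simp only: mult.assoc)
      qed
      finally show ?thesis .
    qed
    ultimately show ?thesis
      unfolding is_mixture_def n_def[symmetric] by blast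
  qed
  \<comment> \<open>\<open>E\<close> is the fixed-point error of the random point and
    \<open>T\<close> the radius allowed in \<open>X_f\<close>. The expected error has order
    \<open>x ^ 14\<close> and the radius order \<open>x ^ 15\<close>, so Markov's inequality gains
    the factor \<open>1 / x\<close>.\<close>
  define E where "E = (\<lambda>X. \<Sum>e\<in>edge_set N. \<bar>p X e - (1 + tanh (pdiff f e (p X))) / 2\<bar>)"
  define T where "T = 5000 * C\<^sup>2 * x ^ 15"
  have T0: "T > 0" using C x1 by (simp add: T_def)
  have E0: "E X \<ge> 0" for X unfolding E_def by (intro sum_nonneg) auto
  have E_exp: "measure_pmf.expectation G E \<le> C\<^sup>2 * x ^ 14"
  proof -
    have "measure_pmf.expectation G E = (\<Sum>X\<in>?P. E X * pmf G X)"
      by (rule integral_measure_pmf_real) (use G in auto)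
    also have "\<dots> \<le> (C * sqrt (2 / real s) * n + C / 12 * (2 * real s * real N + (C * sqrt (2 / real s) * n) / 2)) / 2"
      using err by (simp add: E_def G mult.commute)
    also have "\<dots> \<le> (2 * C * x ^ 14 + C / 12 * (5 * C * x ^ 14)) / 2"
      using C by (intro divide_right_mono add_mono mult_left_mono cost_bd eta_bd) auto
    also have "\<dots> = (C + 5 / 24 * C\<^sup>2) * x ^ 14"
      by (simp add: power2_eq_square algebra_simps)
    \<comment> \<open>Since \<open>C\<close> is at least 2, the linear term is at most half of
      \<open>C\<^sup>2\<close>, and 1/2 + 5/24 < 1.\<close>
    also have "\<dots> \<le> C\<^sup>2 * x ^ 14"
    proof (rule mult_right_mono)
      have "C * 2 \<le> C * C" using C by (intro mult_left_mono) auto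
      then show "C + 5 / 24 * C\<^sup>2 \<le> C\<^sup>2"
        unfolding power2_eq_square using zero_le_square[of C] by linarith
    qed (use x1 in simp)
    finally show ?thesis .
  qed
  have "measure_pmf.prob G {X \<in> space G. T \<le> E X} \<le> measure_pmf.expectation G E / T"
    by (rule integral_Markov_inequality_measure[of _ _ UNIV])
      (use T0 E0 G(2) in \<open>auto intro!: integrable_measure_pmf_finite intro: finite_subset\<close>)
  also have "\<dots> \<le> C\<^sup>2 * x ^ 14 / T" using T0 E_exp by (intro divide_right_mono) auto
  also have "\<dots> = 1 / (5000 * x)"
  proof -
    have "x ^ 15 = x * x ^ 14" by (simp flip: power_Suc)
    then show ?thesis using C x1 by (simp add: T_def)
  qed
  also have "\<dots> \<le> 80 * C / x"
    using C x1 by (simp add: field_simps)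
  finally have bad: "measure_pmf.prob G {X. T \<le> E X} \<le> 80 * C / x" by simp
  have "1 - 80 * C / x \<le> measure_pmf.prob G (- {X. T \<le> E X})"
    using bad measure_pmf.prob_compl[of "{X. T \<le> E X}" G] by (simp add: Compl_eq_Diff_UNIV)
  \<comment> \<open>Off the bad event the error is strictly below \<open>T\<close>, and
    \<open>p X\<close> always lies in the cube.\<close>
  also have "\<dots> \<le> measure_pmf.prob G {X. p X \<in> X_f N f C}"
    using p_cube by (intro measure_pmf.finite_measure_mono)
      (auto simp: X_f_def E_def T_def not_le n_def[symmetric] xn(1))
  also have "\<dots> = measure \<rho> (X_f N f C)"
    by (rule meas_\<rho>[symmetric]) (simp add: f_def X_f_sets[OF assms(2)])
  finally have good: "measure \<rho> (X_f N f C) \<ge> 1 - 80 * C / x" .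
  have "measure \<rho> (cube N) = 1"
    using p_cube by (simp add: meas_\<rho>[OF cube_sets])
  with prob sets_\<rho> mixture good show ?thesis
    unfolding f_def C_def n_def x_def by blast
qed

end
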